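(* Let $d\ge 1$. There is an open dense set of positive semidefinite binary forms $f\in\mathbb{R}[x_1,x_2]$ of degree $2d$ (open and dense in $\Sigma_{2d}$) for which the Gram spectrahedron $\mathrm{Gram}(f)$ has extreme points of all ranks in the Pataki interval; that is, for every integer $r$ with $r\ge 2$ and $\binom{r+1}{2}\le 2d+1$, $\mathrm{Gram}(f)$ has an extreme point of rank $r$.
   Context: Let $V=\mathbb{R}[x_1,x_2]_d$ be the space of real binary forms of degree $d$, and let $\Sigma_{2d}\subset\mathbb{R}[x_1,x_2]_{2d}$ be the cone of sums of squares of forms in $V$; it equals the cone of all positive semidefinite (i.e. nonnegative on $\mathbb{R}^2$) binary forms of degree $2d$. It carries the topology induced from the finite-dimensional real vector space $\mathbb{R}[x_1,x_2]_{2d}$. Let $\mathsf{S}_2V\subset V\otimes V$ be the space of symmetric tensors (those invariant under $v\otimes w\mapsto w\otimes v$), let $\mathsf{S}_2^+V=\{\sum_{i=1}^r p_i\otimes p_i: r\ge 0,\ p_i\in V\}$ be the cone of positive semidefinite symmetric tensors, and let $\mu:\mathsf{S}_2V\to\mathbb{R}[x_1,x_2]_{2d}$ be the linear map induced by multiplication $p\otimes q\mapsto pq$. For $f\in\Sigma_{2d}$, the Gram spectrahedron is $\mathrm{Gram}(f)=\mathsf{S}_2^+V\cap\mu^{-1}(f)$, a closed convex set. The rank of $\theta\in\mathsf{S}_2V$ is the rank of the associated linear map $V^\vee\to V$; for $\theta=\sum_{i=1}^r p_i\otimes p_i$ with $p_1,\dots,p_r$ linearly independent it equals $r$. *)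

theory Defs
  imports "HOL-Analysis.Analysis" "HOL-Analysis.Finite_Function_Topology"
begin

text \<open>
  The polynomial ring \<open>\<real>[x\<^sub>1,x\<^sub>2]\<close> is the monoid algebra of \<open>\<nat> \<times> \<nat>\<close>: the monomial
  \<open>x\<^sub>1\<^sup>i x\<^sub>2\<^sup>j\<close> is \<open>single (i, j) 1\<close>. The library makes this type a commutative ring and a real
  normed vector space (the norm is the sum of the absolute values of the coefficients), so every
  subspace of forms of fixed degree carries its usual finite-dimensional topology.
\<close>
type_synonym bipoly = "(nat \<times> nat) \<Rightarrow>\<^sub>0 real"

definition forms :: "nat \<Rightarrow> bipoly set" where
  "forms n = {p. \<forall>(i, j)\<in>Poly_Mapping.keys p. i + j = n}"

text \<open>The cone \<open>\<Sigma>\<^sub>2\<^sub>d\<close>; the argument is \<open>d\<close>, not \<open>2d\<close>.\<close>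
definition sos_cone :: "nat \<Rightarrow> bipoly set" where
  "sos_cone d = {f. \<exists>(r::nat) p. (\<forall>i<r. p i \<in> forms d) \<and> f = (\<Sum>i<r. (p i)\<^sup>2)}"

text \<open>
  The tensor square of \<open>\<real>[x\<^sub>1,x\<^sub>2]\<close> in the basis of pairs of monomials: \<open>single (a, b) 1\<close> is the
  tensor product of the monomials with exponents \<open>a\<close> and \<open>b\<close>. Tensors over \<open>V = forms d\<close> are
  elements of the span of the pure tensors of elements of \<open>V\<close>.
\<close>
type_synonym bitensor = "((nat \<times> nat) \<times> (nat \<times> nat)) \<Rightarrow>\<^sub>0 real"

lift_definition tensor :: "bipoly \<Rightarrow> bipoly \<Rightarrow> bitensor"
  is "\<lambda>p q (a, b). p a * q b"
proof -
  fix p q :: "nat \<times> nat \<Rightarrow> real"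
  assume "finite {a. p a \<noteq> 0}" "finite {b. q b \<noteq> 0}"
  then have "finite ({a. p a \<noteq> 0} \<times> {b. q b \<noteq> 0})"
    by blast
  then show "finite {c. (case c of (a, b) \<Rightarrow> p a * q b) \<noteq> 0}"
    by (rule rev_finite_subset) auto
qed

definition tensor_square :: "nat \<Rightarrow> bitensor set" where
  "tensor_square d = span {tensor p q |p q. p \<in> forms d \<and> q \<in> forms d}"

definition sym_tensors :: "nat \<Rightarrow> bitensor set" where
  "sym_tensors d = {\<theta> \<in> tensor_square d. Poly_Mapping.map_key prod.swap \<theta> = \<theta>}"

definition psd_tensors :: "nat \<Rightarrow> bitensor set" where
  "psd_tensors d =
     {\<theta> \<in> sym_tensors d. \<exists>(r::nat) p. (\<forall>i<r. p i \<in> forms d) \<and> \<theta> = (\<Sum>i<r. tensor (p i) (p i))}"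

text \<open>The linear map with prescribed values on the standard basis.\<close>
definition lin_ext :: "('a \<Rightarrow> 'b::real_vector) \<Rightarrow> ('a \<Rightarrow>\<^sub>0 real) \<Rightarrow> 'b" where
  "lin_ext g \<theta> = (\<Sum>k\<in>Poly_Mapping.keys \<theta>. Poly_Mapping.lookup \<theta> k *\<^sub>R g k)"

definition mult_map :: "bitensor \<Rightarrow> bipoly" where
  "mult_map = lin_ext (\<lambda>(a, b). Poly_Mapping.single (a + b) 1)"

definition Gram :: "nat \<Rightarrow> bipoly \<Rightarrow> bitensor set" where
  "Gram d f = psd_tensors d \<inter> mult_map -` {f}"

text \<open>The contraction \<open>p \<otimes> q \<mapsto> l(p) q\<close> of the first tensor factor with a linear functional \<open>l\<close>.\<close>
definition contract :: "(bipoly \<Rightarrow> real) \<Rightarrow> bitensor \<Rightarrow> bipoly" where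
  "contract l = lin_ext (\<lambda>(a, b). l (Poly_Mapping.single a 1) *\<^sub>R Poly_Mapping.single b 1)"

text \<open>
  The rank of the linear map sending a functional \<open>l\<close> to \<open>contract l \<theta>\<close>. Functionals on the whole
  polynomial ring may be used for \<open>\<theta>\<close> in \<open>tensor_square d\<close>: the contraction depends only on the
  restriction of \<open>l\<close> to \<open>forms d\<close>, and every functional on \<open>forms d\<close> is such a restriction.
\<close>
definition tensor_rank :: "bitensor \<Rightarrow> nat" where
  "tensor_rank \<theta> = dim {contract l \<theta> |l. linear l}"


subsection \<open>Compatibility of the coordinate definitions with pure tensors\<close>

lemma lookup_scaleR_pm: "Poly_Mapping.lookup (c *\<^sub>R \<theta>) k = c *\<^sub>R Poly_Mapping.lookup \<theta> k"
proof -
  have "finite {i. c *\<^sub>R Poly_Mapping.lookup \<theta> i \<noteq> 0}"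
    by (rule finite_subset[OF _ finite_lookup[of \<theta>]]) auto
  then show ?thesis
    by (simp add: scaleR_poly_mapping_def)
qed

lemma lin_ext_superset:
  assumes "finite A" "Poly_Mapping.keys \<theta> \<subseteq> A"
  shows "lin_ext g \<theta> = (\<Sum>k\<in>A. Poly_Mapping.lookup \<theta> k *\<^sub>R g k)"
  unfolding lin_ext_def using assms by (intro sum.mono_neutral_left) (auto simp: in_keys_iff)

lemma linear_lin_ext: "linear (lin_ext g)"
proof (rule linearI)
  fix x y :: "'a \<Rightarrow>\<^sub>0 real"
  let ?A = "Poly_Mapping.keys x \<union> Poly_Mapping.keys y"
  have "Poly_Mapping.keys (x + y) \<subseteq> ?A"
    by (rule keys_add)
  then show "lin_ext g (x + y) = lin_ext g x + lin_ext g y"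
    by (simp add: lin_ext_superset[of ?A] lookup_add scaleR_add_left sum.distrib)
next
  fix c :: real and x :: "'a \<Rightarrow>\<^sub>0 real"
  have "Poly_Mapping.keys (c *\<^sub>R x) \<subseteq> Poly_Mapping.keys x"
    by (auto simp: in_keys_iff lookup_scaleR_pm)
  then show "lin_ext g (c *\<^sub>R x) = c *\<^sub>R lin_ext g x"
    by (simp add: lin_ext_superset[of "Poly_Mapping.keys x"] lookup_scaleR_pm scaleR_sum_right)
qed

lemma bipoly_expansion:
  "(\<Sum>a\<in>Poly_Mapping.keys p. Poly_Mapping.lookup p a *\<^sub>R Poly_Mapping.single a (1::real)) = p"
  by (rule poly_mapping_eqI)
    (auto simp: lookup_sum lookup_scaleR_pm lookup_single when_def in_keys_iff
      if_distrib[of "(*) _"] sum.delta cong: if_cong)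

lemma lookup_tensor:
  "Poly_Mapping.lookup (tensor p q) (a, b) = Poly_Mapping.lookup p a * Poly_Mapping.lookup q b"
  by transfer simp

lemma lin_ext_tensor:
  "lin_ext g (tensor p q) = (\<Sum>a\<in>Poly_Mapping.keys p. \<Sum>b\<in>Poly_Mapping.keys q.
     (Poly_Mapping.lookup p a * Poly_Mapping.lookup q b) *\<^sub>R g (a, b))"
proof -
  have "Poly_Mapping.keys (tensor p q) \<subseteq> Poly_Mapping.keys p \<times> Poly_Mapping.keys q"
    by (auto simp: in_keys_iff lookup_tensor)
  then show ?thesis
    by (subst lin_ext_superset[of "Poly_Mapping.keys p \<times> Poly_Mapping.keys q"])
      (auto simp: sum.cartesian_product lookup_tensor intro!: sum.cong)
qed

lemma linear_mult_map: "linear mult_map"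
  unfolding mult_map_def by (rule linear_lin_ext)

lemma scaleR_single: "c *\<^sub>R Poly_Mapping.single a (x::real) = Poly_Mapping.single a (c * x)"
  by (rule poly_mapping_eqI) (auto simp: lookup_scaleR_pm lookup_single when_def)

lemma mult_map_tensor: "mult_map (tensor p q) = p * q"
proof -
  have "p * q = (\<Sum>a\<in>Poly_Mapping.keys p. Poly_Mapping.lookup p a *\<^sub>R Poly_Mapping.single a 1)
      * (\<Sum>b\<in>Poly_Mapping.keys q. Poly_Mapping.lookup q b *\<^sub>R Poly_Mapping.single b 1)"
    by (simp only: bipoly_expansion)
  then show ?thesis
    by (simp add: mult_map_def lin_ext_tensor sum_product scaleR_single mult_single)
qed

lemma linear_contract: "linear (contract l)"
  unfolding contract_def by (rule linear_lin_ext)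

lemma contract_tensor:
  assumes "linear l"
  shows "contract l (tensor p q) = l p *\<^sub>R q"
proof -
  have "l p *\<^sub>R q = l (\<Sum>a\<in>Poly_Mapping.keys p. Poly_Mapping.lookup p a *\<^sub>R Poly_Mapping.single a 1)
      *\<^sub>R (\<Sum>b\<in>Poly_Mapping.keys q. Poly_Mapping.lookup q b *\<^sub>R Poly_Mapping.single b 1)"
    by (simp only: bipoly_expansion)
  also have "\<dots> = (\<Sum>a\<in>Poly_Mapping.keys p. \<Sum>b\<in>Poly_Mapping.keys q.
     (Poly_Mapping.lookup p a * Poly_Mapping.lookup q b) *\<^sub>R
       (l (Poly_Mapping.single a 1) *\<^sub>R Poly_Mapping.single b 1))"
    unfolding linear_sum[OF assms] linear_cmul[OF assms] scaleR_sum_left scaleR_sum_right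
    by (subst sum.swap) (simp add: mult_ac)
  finally show ?thesis
    by (simp add: contract_def lin_ext_tensor)
qed

lemma psd_tensors_eq:
  "psd_tensors d = {\<Sum>i<r. tensor (p i) (p i) |(r::nat) p. \<forall>i<r. p i \<in> forms d}"
proof -
  have "(\<Sum>i<r. tensor (p i) (p i)) \<in> sym_tensors d" if "\<forall>i<r. p i \<in> forms d" for r :: nat and p
  proof -
    have "(\<Sum>i<r. tensor (p i) (p i)) \<in> tensor_square d"
      unfolding tensor_square_def using that by (intro span_sum span_base) blast
    moreover have "Poly_Mapping.map_key prod.swap (\<Sum>i<r. tensor (p i) (p i)) = (\<Sum>i<r. tensor (p i) (p i))"
      by (rule poly_mapping_eqI)
        (auto simp: map_key.rep_eq lookup_sum lookup_tensor mult.commute)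
    ultimately show ?thesis
      by (simp add: sym_tensors_def)
  qed
  then show ?thesis
    unfolding psd_tensors_def by blast
qed

lemma tensor_rank_sum:
  assumes "inj_on p {..<r::nat}" "independent (p ` {..<r})"
  shows "tensor_rank (\<Sum>i<r. tensor (p i) (p i)) = r"
proof -
  have *: "contract l (\<Sum>i<r. tensor (p i) (p i)) = (\<Sum>i<r. l (p i) *\<^sub>R p i)" if "linear l" for l
    by (simp add: linear_sum[OF linear_contract] contract_tensor[OF that])
  have "{contract l (\<Sum>i<r. tensor (p i) (p i)) |l. linear l} = span (p ` {..<r})"
  proof (intro equalityI subsetI)
    fix x assume "x \<in> {contract l (\<Sum>i<r. tensor (p i) (p i)) |l. linear l}"
    then show "x \<in> span (p ` {..<r})"
      by (auto simp: * intro!: span_sum span_scale intro: span_base[OF imageI])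
  next
    fix x assume "x \<in> span (p ` {..<r})"
    then obtain u where u: "x = (\<Sum>v\<in>p ` {..<r}. u v *\<^sub>R v)"
      by (auto simp: span_finite)
    obtain l where l: "linear l" "\<forall>v\<in>p ` {..<r}. l v = u v"
      using linear_independent_extend[OF assms(2)] by blast
    have "x = (\<Sum>i<r. l (p i) *\<^sub>R p i)"
      using l(2) by (simp add: u sum.reindex[OF assms(1)])
    then show "x \<in> {contract l (\<Sum>i<r. tensor (p i) (p i)) |l. linear l}"
      using *[OF l(1), symmetric] l(1) by blast
  qed
  then show ?thesis
    unfolding tensor_rank_def
    by (simp add: dim_span dim_eq_card_independent[OF assms(2)] card_image[OF assms(1)])
qed

end

theory Submission
  imports Defs "HOL-Computational_Algebra.Fundamental_Theorem_Algebra"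
begin

text \<open>
  Call forms \<open>p\<^sub>1, \<dots>, p\<^sub>r\<close> in \<open>V\<close> quadratically independent if their products \<open>p\<^sub>i p\<^sub>j\<close>, \<open>i \<le> j\<close>,
  are linearly independent. If \<open>f = \<Sum> p\<^sub>i\<^sup>2\<close> for such forms, then \<open>\<theta> = \<Sum> p\<^sub>i \<otimes> p\<^sub>i\<close> is an extreme
  point of \<open>Gram(f)\<close> of rank \<open>r\<close> (\<open>qindep_extreme_point\<close>): whenever \<open>\<theta>\<close> lies in an open segment with
  end points in \<open>Gram(f)\<close>, positive semidefiniteness forces the end points to be tensors over the
  span of the \<open>p\<^sub>i\<close>, and multiplication is injective on the symmetric tensors over that span. It
  remains to find, for a general \<open>f\<close> and for each \<open>r\<close>, a representation of \<open>f\<close> by quadratically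
  independent forms.

  The map \<open>(p\<^sub>1, \<dots>, p\<^sub>r) \<mapsto> \<Sum> p\<^sub>i\<^sup>2\<close> from \<open>V\<^sup>r\<close> to \<open>\<Sigma>\<^sub>2\<^sub>d\<close> is onto for \<open>r \<ge> 2\<close>, since a nonnegative
  binary form is a sum of two squares (\<open>sos_cone_two_squares\<close>). It is open at every tuple for which
  \<open>p\<^sub>1 V + p\<^sub>2 V\<close> is the space of all forms of degree \<open>2d\<close>: there it is enough to move \<open>p\<^sub>1\<close> and \<open>p\<^sub>2\<close>
  (\<open>sum_two_squares_locally_surjective\<close>, a contraction argument). Both this condition and quadratic
  independence say that some family depending polynomially on the tuple is linearly independent.
  On a line in \<open>V\<^sup>r\<close> such a condition fails at finitely many points only, as soon as it holds
  at one point of the line (\<open>finite_dependent_poly_curve\<close>). Hence the good tuples are dense once each of the two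
  conditions can be satisfied, and the sums of squares of good tuples contain a dense open part
  of \<open>\<Sigma>\<^sub>2\<^sub>d\<close>. Finitely many values of \<open>r\<close> are in question, so these open parts may be intersected.

  The heart of the matter is that quadratically independent forms exist when
  \<open>(r + 1 choose 2) \<le> 2d + 1\<close> (\<open>exists_qindep\<close>). Geometrically, one needs a rational curve of degree
  \<open>d\<close> in projective space of dimension \<open>r - 1\<close> that lies on no quadric. Degenerate the curve to a
  chain of \<open>d\<close> lines through points \<open>u\<^sub>0, \<dots>, u\<^sub>d\<close>: for
  \<open>p\<^sub>i = \<Sum>\<^sub>k t^(k\<^sup>2) u\<^sub>k(i) x\<^sup>k y\<^sup>d\<^sup>-\<^sup>k\<close> the leading terms for \<open>t \<rightarrow> 0\<close> of the \<open>2d + 1\<close> coefficients of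
  \<open>\<Sum> A\<^sub>i\<^sub>j p\<^sub>i p\<^sub>j\<close> are \<open>A(u\<^sub>k, u\<^sub>k)\<close> and \<open>2 A(u\<^sub>k, u\<^sub>k\<^sub>+\<^sub>1)\<close>. So it suffices to find a chain of vectors for which
  the vanishing of these \<open>2d + 1\<close> numbers implies \<open>A = 0\<close>. Such chains are built
  by passing from \<open>r\<close> to \<open>r + 4\<close> (\<open>exists_determining_chain\<close>): every new \<open>u\<^sub>k\<close> is a basis vector \<open>e\<^sub>a\<close> with
  a small multiple of a second one \<open>e\<^sub>b\<close> added, which turns the problem into covering the edges and
  loops of a complete graph by a walk \<open>a\<^sub>0, a\<^sub>1, \<dots>\<close> in which each visit accounts for one further pair
  \<open>{a, b}\<close>.
\<close>

section \<open>Linearly independent families and polynomial curves\<close>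

definition indep_family :: "'i set \<Rightarrow> ('i \<Rightarrow> 'a::real_vector) \<Rightarrow> bool" where
  "indep_family I v \<longleftrightarrow> (\<forall>c. (\<Sum>i\<in>I. c i *\<^sub>R v i) = 0 \<longrightarrow> (\<forall>i\<in>I. c i = 0))"

lemma indep_family_cong:
  assumes "\<And>i. i \<in> I \<Longrightarrow> v i = w i"
  shows "indep_family I v \<longleftrightarrow> indep_family I w"
proof -
  have "(\<Sum>i\<in>I. c i *\<^sub>R v i) = (\<Sum>i\<in>I. c i *\<^sub>R w i)" for c
    by (rule sum.cong) (simp_all add: assms)
  then show ?thesis
    by (simp add: indep_family_def)
qed

lemma indep_family_independent:
  assumes I: "finite I" "indep_family I v"
  shows "inj_on v I" "independent (v ` I)"
proof -
  show inj: "inj_on v I"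
  proof (rule inj_onI, rule ccontr)
    fix i j assume ij: "i \<in> I" "j \<in> I" "v i = v j" "i \<noteq> j"
    have "(\<Sum>k\<in>I. (of_bool (k = i) - of_bool (k = j)) *\<^sub>R v k)
        = (\<Sum>k\<in>I. if k = i then v k else 0) - (\<Sum>k\<in>I. if k = j then v k else 0)"
      unfolding sum_subtractf[symmetric] by (rule sum.cong) auto
    also have "\<dots> = 0"
      using ij I(1) by (simp add: sum.delta)
    finally show False
      using I(2) ij unfolding indep_family_def by force
  qed
  show "independent (v ` I)"
  proof (rule independent_if_scalars_zero)
    fix f x assume "(\<Sum>x\<in>v ` I. f x *\<^sub>R x) = 0" "x \<in> v ` I"
    then show "f x = 0"
      using I(2) unfolding indep_family_def by (auto simp: sum.reindex[OF inj])
  qed (use I in simp)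
qed

lemma indep_family_dual:
  assumes "finite I" "indep_family I v"
  shows "\<exists>l. \<forall>i\<in>I. linear (l i) \<and> (\<forall>j\<in>I. l i (v j) = (of_bool (i = j) :: real))"
proof -
  note * = indep_family_independent[OF assms]
  have "\<exists>l. linear l \<and> (\<forall>j\<in>I. l (v j) = (of_bool (i = j) :: real))" if "i \<in> I" for i
  proof -
    obtain l where l: "linear l" "\<forall>x\<in>v ` I. l x = (of_bool (x = v i) :: real)"
      using linear_independent_extend[OF *(2), of "\<lambda>x. of_bool (x = v i)"] by blast
    then show ?thesis
      using *(1) that by (intro exI[of _ l]) (auto simp: inj_on_eq_iff)
  qed
  then show ?thesis
    by metis
qed

text \<open>
  A relation between the vectors passes to their images. This undoes a rescaling of coordinates.
\<close>
lemma indep_family_linear_image: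
  assumes "linear h" "indep_family I (\<lambda>i. h (v i))"
  shows "indep_family I v"
  unfolding indep_family_def
proof (intro allI impI)
  fix c assume "(\<Sum>i\<in>I. c i *\<^sub>R v i) = 0"
  then have "h (\<Sum>i\<in>I. c i *\<^sub>R v i) = 0"
    by (simp add: linear_0[OF assms(1)])
  then have "(\<Sum>i\<in>I. c i *\<^sub>R h (v i)) = 0"
    by (simp add: linear_sum[OF assms(1)] linear_cmul[OF assms(1)])
  then show "\<forall>i\<in>I. c i = 0"
    using assms(2) unfolding indep_family_def by blast
qed

text \<open>
  Testing against all linear functionals makes sense in spaces of infinite dimension and gives
  exactly what elimination needs: the coordinates of the curve are polynomials in the parameter.
\<close>
definition poly_curve :: "(real \<Rightarrow> 'a::real_vector) \<Rightarrow> bool" where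
  "poly_curve f \<longleftrightarrow> (\<forall>l. linear l \<longrightarrow> (\<exists>P. \<forall>t. l (f t) = poly P t))"

lemma poly_curveI: "(\<And>l. linear l \<Longrightarrow> \<exists>P. \<forall>t. l (f t) = poly P t) \<Longrightarrow> poly_curve f"
  unfolding poly_curve_def by blast

lemma poly_curveE:
  assumes "poly_curve f" "linear l"
  obtains P where "\<And>t. l (f t) = poly P t"
  using assms unfolding poly_curve_def by blast

lemma poly_curve_const: "poly_curve (\<lambda>t. a)"
  by (rule poly_curveI) (rule exI[of _ "[:_:]"], simp)

lemma poly_curve_add:
  assumes "poly_curve f" "poly_curve g"
  shows "poly_curve (\<lambda>t. f t + g t)"
proof (rule poly_curveI)
  fix l :: "'a \<Rightarrow> real" assume l: "linear l"
  obtain P Q where "\<And>t. l (f t) = poly P t" "\<And>t. l (g t) = poly Q t"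
    using assms l by (metis poly_curveE)
  then show "\<exists>R. \<forall>t. l (f t + g t) = poly R t"
    by (intro exI[of _ "P + Q"]) (simp add: linear_add[OF l])
qed

lemma poly_curve_scaleR:
  assumes "poly_curve f"
  shows "poly_curve (\<lambda>t. poly P t *\<^sub>R f t)"
proof (rule poly_curveI)
  fix l :: "'a \<Rightarrow> real" assume l: "linear l"
  obtain Q where "\<And>t. l (f t) = poly Q t"
    using assms l by (metis poly_curveE)
  then show "\<exists>R. \<forall>t. l (poly P t *\<^sub>R f t) = poly R t"
    by (intro exI[of _ "P * Q"]) (simp add: linear_cmul[OF l])
qed

lemma poly_curve_diff:
  assumes "poly_curve f" "poly_curve g"
  shows "poly_curve (\<lambda>t. f t - g t)"
  using poly_curve_add[OF assms(1) poly_curve_scaleR[OF assms(2), of "- 1"]] by simp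

lemma poly_curve_sum: "(\<And>i. i \<in> I \<Longrightarrow> poly_curve (f i)) \<Longrightarrow> poly_curve (\<lambda>t. \<Sum>i\<in>I. f i t)"
  by (induction I rule: infinite_finite_induct) (auto intro: poly_curve_const poly_curve_add)

lemma poly_curve_power: "poly_curve (\<lambda>t. t ^ n *\<^sub>R a)"
  using poly_curve_scaleR[OF poly_curve_const, of "monom 1 n" a] by (simp add: poly_monom)

text \<open>
  One step of Gaussian elimination with pivot \<open>l (v i)\<close>: the new vectors are the combinations of
  \<open>v j\<close> and \<open>v i\<close> that \<open>l\<close> annihilates. No division occurs, so polynomial dependence on a parameter
  is preserved.
\<close>
lemma indep_family_insert_elim:
  assumes I: "finite I" "i \<notin> I" and l: "linear (l :: 'a::real_vector \<Rightarrow> real)" and nz: "l (v i) \<noteq> 0"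
  shows "indep_family (insert i I) v \<longleftrightarrow> indep_family I (\<lambda>j. l (v i) *\<^sub>R v j - l (v j) *\<^sub>R v i)"
    (is "_ \<longleftrightarrow> indep_family I ?w")
proof -
  have w: "(\<Sum>j\<in>I. c j *\<^sub>R ?w j) = l (v i) *\<^sub>R (\<Sum>j\<in>I. c j *\<^sub>R v j) - l (\<Sum>j\<in>I. c j *\<^sub>R v j) *\<^sub>R v i" for c
    by (simp add: linear_sum[OF l] linear_cmul[OF l] scaleR_sum_right scaleR_sum_left algebra_simps sum_subtractf)
  show ?thesis
    unfolding indep_family_def
  proof (intro iffI allI impI)
    fix c assume *: "\<forall>c. (\<Sum>j\<in>insert i I. c j *\<^sub>R v j) = 0 \<longrightarrow> (\<forall>j\<in>insert i I. c j = 0)"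
      and c: "(\<Sum>j\<in>I. c j *\<^sub>R ?w j) = 0"
    \<comment> \<open>lifts the relation \<open>c\<close> to the vectors before elimination\<close>
    define e where "e = (\<lambda>j. if j = i then - l (\<Sum>j\<in>I. c j *\<^sub>R v j) else l (v i) * c j)"
    have "(\<Sum>j\<in>I. e j *\<^sub>R v j) = (\<Sum>j\<in>I. (l (v i) * c j) *\<^sub>R v j)"
      using I(2) by (intro sum.cong) (auto simp: e_def)
    then have "(\<Sum>j\<in>insert i I. e j *\<^sub>R v j) = 0"
      using c I unfolding w by (simp add: e_def scaleR_sum_right)
    then have "\<forall>j\<in>insert i I. e j = 0"
      using * by blast
    then show "\<forall>j\<in>I. c j = 0"
      using I(2) nz by (auto simp: e_def split: if_splits)
  next
    fix c assume *: "\<forall>c. (\<Sum>j\<in>I. c j *\<^sub>R ?w j) = 0 \<longrightarrow> (\<forall>j\<in>I. c j = 0)"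
      and c: "(\<Sum>j\<in>insert i I. c j *\<^sub>R v j) = 0"
    have sum: "(\<Sum>j\<in>I. c j *\<^sub>R v j) = - c i *\<^sub>R v i"
      using c I by (simp add: eq_neg_iff_add_eq_0 add.commute)
    have "(\<Sum>j\<in>I. c j *\<^sub>R ?w j) = 0"
      unfolding w sum by (simp add: linear_neg[OF l] linear_cmul[OF l])
    then have c0: "\<forall>j\<in>I. c j = 0"
      using * by blast
    then have "c i *\<^sub>R v i = 0"
      using sum by simp
    moreover have "v i \<noteq> 0"
      using nz linear_0[OF l] by auto
    ultimately show "\<forall>j\<in>insert i I. c j = 0"
      using c0 by simp
  qed
qed

text \<open>
  Elimination at the parameter \<open>t0\<close> works, with the same functionals as pivots, at every parameter
  where the pivots do not vanish. The pivots are polynomials with value \<open>1\<close> at \<open>t0\<close>, so they have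
  finitely many zeros.
\<close>
lemma finite_dependent_poly_curve:
  fixes v :: "real \<Rightarrow> 'i \<Rightarrow> 'a::real_vector"
  assumes "finite I" "\<And>i. i \<in> I \<Longrightarrow> poly_curve (\<lambda>t. v t i)" "indep_family I (v t0)"
  shows "finite {t. \<not> indep_family I (v t)}"
  using assms
proof (induction I arbitrary: v rule: finite_induct)
  case empty
  then show ?case
    by (simp add: indep_family_def)
next
  case (insert i I)
  obtain l where l: "linear l" "l (v t0 i) = (1 :: real)"
    using indep_family_dual[OF _ insert.prems(2)] insert.hyps by fastforce
  obtain Q where Q: "\<And>j t. j \<in> insert i I \<Longrightarrow> l (v t j) = poly (Q j) t"
  proof -
    have "\<forall>j\<in>insert i I. \<exists>P. \<forall>t. l (v t j) = poly P t"
      using insert.prems(1) l(1) unfolding poly_curve_def by blast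
    then show thesis
      using that by metis
  qed
  define w where "w = (\<lambda>t j. poly (Q i) t *\<^sub>R v t j - poly (Q j) t *\<^sub>R v t i)"
  have iff: "indep_family (insert i I) (v t) \<longleftrightarrow> indep_family I (w t)" if "poly (Q i) t \<noteq> 0" for t
  proof -
    have "indep_family I (w t) \<longleftrightarrow> indep_family I (\<lambda>j. l (v t i) *\<^sub>R v t j - l (v t j) *\<^sub>R v t i)"
      unfolding indep_family_def w_def by (simp add: Q cong: sum.cong)
    then show ?thesis
      using indep_family_insert_elim[OF insert.hyps l(1), of "v t"] that Q[of i t] by simp
  qed
  have Qi: "poly (Q i) t0 = 1"
    using l(2) Q[of i t0] by simp
  then have "finite {t. poly (Q i) t = 0}"
    by (intro poly_roots_finite) auto
  moreover have "finite {t. \<not> indep_family I (w t)}"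
  proof (rule insert.IH)
    show "poly_curve (\<lambda>t. w t j)" if "j \<in> I" for j
      unfolding w_def using insert.prems(1) that by (intro poly_curve_diff poly_curve_scaleR) auto
    show "indep_family I (w t0)"
      using iff[of t0] insert.prems(2) Qi by simp
  qed
  moreover have "{t. \<not> indep_family (insert i I) (v t)} \<subseteq> {t. poly (Q i) t = 0} \<union> {t. \<not> indep_family I (w t)}"
    using iff by blast
  ultimately show ?case
    using finite_subset by blast
qed

section \<open>Binary forms of fixed degree\<close>

abbreviation "coef \<equiv> Poly_Mapping.lookup"

definition mon :: "nat \<Rightarrow> nat \<Rightarrow> bipoly" where
  "mon n k = Poly_Mapping.single (k, n - k) 1"

lemma subspace_forms: "subspace (forms n)"
proof (rule subspaceI)
  show "x + y \<in> forms n" if "x \<in> forms n" "y \<in> forms n" for x y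
    using that keys_add[of x y] unfolding forms_def by blast
  show "c *\<^sub>R x \<in> forms n" if "x \<in> forms n" for c x
    using that unfolding forms_def by (auto simp: in_keys_iff lookup_scaleR_pm)
qed (simp add: forms_def)

lemmas forms_closed = subspace_add[OF subspace_forms] subspace_diff[OF subspace_forms]
  subspace_scale[OF subspace_forms] subspace_0[OF subspace_forms]

lemma forms_mult: "p \<in> forms m \<Longrightarrow> q \<in> forms n \<Longrightarrow> p * q \<in> forms (m + n)"
  using keys_mult[of p q] unfolding forms_def by fastforce

lemma forms_square: "p \<in> forms d \<Longrightarrow> p\<^sup>2 \<in> forms (2 * d)"
  unfolding power2_eq_square mult_2 by (rule forms_mult)

lemma mon_in_forms: "k \<le> n \<Longrightarrow> mon n k \<in> forms n"
  by (simp add: mon_def forms_def)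

lemma mon_mult: "i \<le> m \<Longrightarrow> j \<le> n \<Longrightarrow> mon m i * mon n j = mon (m + n) (i + j)"
  by (simp add: mon_def mult_single)

lemma coef_mon: "coef (mon n k) (i, n - i) = of_bool (i = k)"
  by (auto simp: mon_def lookup_single when_def)

lemma forms_keys: "p \<in> forms n \<Longrightarrow> Poly_Mapping.keys p \<subseteq> (\<lambda>k. (k, n - k)) ` {..n}"
  unfolding forms_def by force

lemma inj_exponent: "inj_on (\<lambda>k. (k, n - k)) A"
  by (auto intro: inj_onI)

lemma forms_expansion: "p \<in> forms n \<Longrightarrow> p = (\<Sum>k\<le>n. coef p (k, n - k) *\<^sub>R mon n k)"
proof -
  assume "p \<in> forms n"
  then have "(\<Sum>a\<in>Poly_Mapping.keys p. coef p a *\<^sub>R Poly_Mapping.single a (1::real))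
      = (\<Sum>a\<in>(\<lambda>k. (k, n - k)) ` {..n}. coef p a *\<^sub>R Poly_Mapping.single a 1)"
    using forms_keys by (intro sum.mono_neutral_left) (auto simp: in_keys_iff)
  then show ?thesis
    by (simp add: bipoly_expansion sum.reindex[OF inj_exponent] mon_def)
qed

lemma forms_eqI:
  assumes "p \<in> forms n" "q \<in> forms n" "\<And>k. k \<le> n \<Longrightarrow> coef p (k, n - k) = coef q (k, n - k)"
  shows "p = q"
  using forms_expansion[OF assms(1)] forms_expansion[OF assms(2)] assms(3) by simp

lemma sum_mon_in_forms: "(\<Sum>k\<le>n. c k *\<^sub>R mon n k) \<in> forms n"
  by (intro subspace_sum[OF subspace_forms] subspace_scale[OF subspace_forms] mon_in_forms) simp

lemma coef_sum_mon:
  assumes "k \<le> n"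
  shows "coef (\<Sum>i\<le>n. c i *\<^sub>R mon n i) (k, n - k) = c k"
  using assms by (simp add: lookup_sum lookup_scaleR_pm coef_mon of_bool_def if_distrib[of "(*) _"] cong: if_cong)

lemma scaleR_bipoly_mult: 
  fixes p q :: bipoly
  shows "(c *\<^sub>R p) * q = c *\<^sub>R (p * q)" "p * (c *\<^sub>R q) = c *\<^sub>R (p * q)"
proof -
  have *: "c *\<^sub>R p = Poly_Mapping.single 0 c * p" for p :: bipoly
  proof -
    have "Poly_Mapping.single 0 c * (\<Sum>a\<in>Poly_Mapping.keys p. coef p a *\<^sub>R Poly_Mapping.single a (1::real))
        = c *\<^sub>R (\<Sum>a\<in>Poly_Mapping.keys p. coef p a *\<^sub>R Poly_Mapping.single a 1)"
      by (simp add: sum_distrib_left scaleR_sum_right scaleR_single mult_single)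
    then show ?thesis
      by (simp only: bipoly_expansion)
  qed
  show "(c *\<^sub>R p) * q = c *\<^sub>R (p * q)" "p * (c *\<^sub>R q) = c *\<^sub>R (p * q)"
    unfolding * by (simp_all add: mult_ac)
qed

lemma scaleR_mult_scaleR_bipoly: "(a *\<^sub>R p) * (b *\<^sub>R q) = (a * b) *\<^sub>R (p * q)" for p q :: bipoly
  by (simp only: scaleR_bipoly_mult scaleR_scaleR mult.commute)

lemma norm_bipoly: "norm p = (\<Sum>a\<in>Poly_Mapping.keys p. \<bar>coef p a\<bar>)" for p :: bipoly
  by (simp add: norm_poly_mapping_def dist_poly_mapping_def)

lemma norm_forms: "p \<in> forms n \<Longrightarrow> norm p = (\<Sum>k\<le>n. \<bar>coef p (k, n - k)\<bar>)"
proof -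
  assume "p \<in> forms n"
  then have "norm p = (\<Sum>a\<in>(\<lambda>k. (k, n - k)) ` {..n}. \<bar>coef p a\<bar>)"
    unfolding norm_bipoly using forms_keys by (intro sum.mono_neutral_left) (auto simp: in_keys_iff)
  then show ?thesis
    by (simp add: sum.reindex[OF inj_exponent])
qed

lemma norm_single: "norm (Poly_Mapping.single a c :: bipoly) = \<bar>c\<bar>"
  by (cases "c = 0") (simp_all add: norm_bipoly)

lemma norm_bipoly_mult: "norm (p * q) \<le> norm p * norm q" for p q :: bipoly
proof -
  have "p * q = (\<Sum>a\<in>Poly_Mapping.keys p. coef p a *\<^sub>R Poly_Mapping.single a 1)
      * (\<Sum>b\<in>Poly_Mapping.keys q. coef q b *\<^sub>R Poly_Mapping.single b 1)"
    by (simp only: bipoly_expansion)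
  also have "\<dots> = (\<Sum>a\<in>Poly_Mapping.keys p. \<Sum>b\<in>Poly_Mapping.keys q. Poly_Mapping.single (a + b) (coef p a * coef q b))"
    by (simp add: sum_product scaleR_single mult_single)
  also have "norm \<dots> \<le> (\<Sum>a\<in>Poly_Mapping.keys p. \<Sum>b\<in>Poly_Mapping.keys q. \<bar>coef p a * coef q b\<bar>)"
    by (intro order_trans[OF norm_sum] sum_mono order_trans[OF norm_sum]) (simp add: norm_single)
  also have "\<dots> = norm p * norm q"
    by (simp add: norm_bipoly sum_product abs_mult)
  finally show ?thesis .
qed

text \<open>
  The coefficients of a form are bounded by its norm, and there are \<open>n + 1\<close> of them.
\<close>
lemma linear_bounded_on_forms:
  fixes l :: "bipoly \<Rightarrow> 'b::real_normed_vector"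
  assumes "linear l"
  obtains C where "C > 0" "\<And>y. y \<in> forms n \<Longrightarrow> norm (l y) \<le> C * norm y"
proof
  let ?C = "1 + (\<Sum>k\<le>n. norm (l (mon n k)))"
  show "?C > 0"
    by (simp add: add_pos_nonneg sum_nonneg)
  fix y assume y: "y \<in> forms n"
  have "l y = l (\<Sum>k\<le>n. coef y (k, n - k) *\<^sub>R mon n k)"
    by (simp only: forms_expansion[OF y, symmetric])
  also have "\<dots> = (\<Sum>k\<le>n. coef y (k, n - k) *\<^sub>R l (mon n k))"
    by (simp add: linear_sum[OF assms] linear_cmul[OF assms])
  also have "norm \<dots> \<le> (\<Sum>k\<le>n. \<bar>coef y (k, n - k)\<bar> * norm (l (mon n k)))"
    by (rule order_trans[OF norm_sum]) simp
  also have "\<dots> \<le> (\<Sum>k\<le>n. \<bar>coef y (k, n - k)\<bar> * ?C)"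
  proof (intro sum_mono mult_left_mono)
    fix k assume "k \<in> {..n}"
    then show "norm (l (mon n k)) \<le> ?C"
      using member_le_sum[of k "{..n}" "\<lambda>k. norm (l (mon n k))"] by simp
  qed simp
  also have "\<dots> = ?C * norm y"
    by (simp add: norm_forms[OF y] sum_distrib_left mult.commute)
  finally show "norm (l y) \<le> ?C * norm y" .
qed

lemma coef_le_norm: "\<bar>coef p a\<bar> \<le> norm p" for p :: bipoly
proof (cases "a \<in> Poly_Mapping.keys p")
  case True
  then show ?thesis
    unfolding norm_bipoly by (intro member_le_sum) auto
qed (simp add: in_keys_iff)

text \<open>
  The whole polynomial ring is not complete in its norm, so completeness has to be obtained
  coefficient by coefficient on the finite-dimensional subspace.
\<close>
lemma complete_forms: "complete (forms n)"
proof (rule completeI)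
  fix X assume X: "\<forall>i. X i \<in> forms n" "Cauchy X"
  define L where "L = (\<lambda>a. lim (\<lambda>i. coef (X i) a))"
  have "Cauchy (\<lambda>i. coef (X i) a)" for a
  proof (rule CauchyI)
    fix e :: real assume "e > 0"
    then obtain M where M: "\<And>i j. i \<ge> M \<Longrightarrow> j \<ge> M \<Longrightarrow> norm (X i - X j) < e"
      using CauchyD[OF X(2)] by blast
    show "\<exists>M. \<forall>m\<ge>M. \<forall>n\<ge>M. norm (coef (X m) a - coef (X n) a) < e"
    proof (intro exI allI impI)
      fix i j assume "M \<le> i" "M \<le> j"
      then show "norm (coef (X i) a - coef (X j) a) < e"
        using M[of i j] coef_le_norm[of "X i - X j" a] by (simp add: lookup_minus)
    qed
  qed
  then have L: "(\<lambda>i. coef (X i) a) \<longlonglongrightarrow> L a" for a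
    unfolding L_def by (simp add: Cauchy_convergent convergent_LIMSEQ_iff[symmetric])
  define x where "x = (\<Sum>k\<le>n. L (k, n - k) *\<^sub>R mon n k)"
  have x: "x \<in> forms n"
    unfolding x_def by (rule sum_mon_in_forms)
  have "norm (X i - x) = (\<Sum>k\<le>n. \<bar>coef (X i) (k, n - k) - L (k, n - k)\<bar>)" for i
  proof -
    have "X i - x \<in> forms n"
      using X(1) x by (simp add: forms_closed)
    then have "norm (X i - x) = (\<Sum>k\<le>n. \<bar>coef (X i - x) (k, n - k)\<bar>)"
      by (rule norm_forms)
    then show ?thesis
      by (simp add: lookup_minus x_def coef_sum_mon)
  qed
  note norm = this
  have "(\<lambda>i. \<Sum>k\<le>n. \<bar>coef (X i) (k, n - k) - L (k, n - k)\<bar>) \<longlonglongrightarrow> (\<Sum>k\<le>n. \<bar>L (k, n - k) - L (k, n - k)\<bar>)"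
    by (intro tendsto_sum tendsto_rabs tendsto_diff L tendsto_const)
  then have "(\<lambda>i. norm (X i - x)) \<longlonglongrightarrow> 0"
    unfolding norm by simp
  then have "X \<longlonglongrightarrow> x"
    by (rule LIM_zero_cancel[OF tendsto_norm_zero_cancel])
  then show "\<exists>x\<in>forms n. X \<longlonglongrightarrow> x"
    using x by blast
qed

text \<open>
  The isomorphism between polynomials of degree at most \<open>n\<close> in one variable and binary forms of degree
  \<open>n\<close>. It makes the factorization theory of real polynomials in one variable available for forms.
\<close>
definition homogenize :: "nat \<Rightarrow> real poly \<Rightarrow> bipoly" where
  "homogenize n P = (\<Sum>k\<le>n. coeff P k *\<^sub>R mon n k)"

lemma homogenize_in_forms: "homogenize n P \<in> forms n"
  unfolding homogenize_def by (rule sum_mon_in_forms)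

lemma homogenize_add: "homogenize n (P + Q) = homogenize n P + homogenize n Q"
  by (simp add: homogenize_def scaleR_add_left sum.distrib)

lemma homogenize_sum: "homogenize n (\<Sum>i\<in>I. P i) = (\<Sum>i\<in>I. homogenize n (P i))"
  by (induction I rule: infinite_finite_induct) (simp_all add: homogenize_add, simp_all add: homogenize_def)

lemma homogenize_mult:
  assumes "degree P \<le> m" "degree Q \<le> n"
  shows "homogenize (m + n) (P * Q) = homogenize m P * homogenize n Q"
proof (rule forms_eqI)
  fix k assume k: "k \<le> m + n"
  have "homogenize m P * homogenize n Q = (\<Sum>i\<le>m. \<Sum>j\<le>n. (coeff P i * coeff Q j) *\<^sub>R mon (m + n) (i + j))"
    unfolding homogenize_def sum_product by (intro sum.cong refl) (simp add: scaleR_bipoly_mult mon_mult)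
  also have "coef \<dots> (k, m + n - k) = (\<Sum>i\<le>m. \<Sum>j\<le>n. (coeff P i * coeff Q j) * of_bool (k = i + j))"
    by (simp add: lookup_sum lookup_scaleR_pm coef_mon)
  also have "\<dots> = (\<Sum>i\<le>m. of_bool (i \<le> k) * (coeff P i * coeff Q (k - i)))"
  proof (rule sum.cong[OF refl])
    fix i assume "i \<in> {..m}"
    have "(\<Sum>j\<le>n. (coeff P i * coeff Q j) * of_bool (k = i + j))
        = (\<Sum>j\<in>{..n}. if j = k - i then of_bool (i \<le> k) * (coeff P i * coeff Q (k - i)) else 0)"
      by (rule sum.cong) auto
    also have "\<dots> = of_bool (i \<le> k) * (coeff P i * coeff Q (k - i))"
      using assms(2) by (auto simp: coeff_eq_0)
    finally show "(\<Sum>j\<le>n. (coeff P i * coeff Q j) * of_bool (k = i + j)) = \<dots>" .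
  qed
  also have "\<dots> = (\<Sum>i\<in>{..m} \<union> {..k}. of_bool (i \<le> k) * (coeff P i * coeff Q (k - i)))"
    using assms(1) by (intro sum.mono_neutral_left) (auto simp: coeff_eq_0)
  also have "\<dots> = (\<Sum>i\<le>k. coeff P i * coeff Q (k - i))"
    by (rule sum.mono_neutral_cong_right) auto
  also have "\<dots> = coeff (P * Q) k"
    by (simp add: coeff_mult)
  finally show "coef (homogenize (m + n) (P * Q)) (k, m + n - k) = coef (homogenize m P * homogenize n Q) (k, m + n - k)"
    using k by (simp add: homogenize_def coef_sum_mon)
qed (intro homogenize_in_forms forms_mult)+

lemma homogenize_square: "degree P \<le> d \<Longrightarrow> homogenize (2 * d) (P\<^sup>2) = (homogenize d P)\<^sup>2"
  unfolding power2_eq_square mult_2 by (rule homogenize_mult)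

lemma forms_homogenizeE:
  assumes "p \<in> forms n"
  obtains P where "degree P \<le> n" "p = homogenize n P"
proof
  define P where "P = (\<Sum>k\<le>n. monom (coef p (k, n - k)) k)"
  show "degree P \<le> n"
    unfolding P_def by (intro degree_sum_le) (auto intro: order_trans[OF degree_monom_le])
  have "coeff P k = coef p (k, n - k)" if "k \<le> n" for k
    using that by (simp add: P_def coeff_sum)
  then show "p = homogenize n P"
    using forms_expansion[OF assms] by (simp add: homogenize_def)
qed

section \<open>Quadratically independent forms and extreme points\<close>

text \<open>
  For a symmetric \<open>v\<close>, independence of the \<open>v i j\<close> with \<open>i \<le> j\<close>, phrased through symmetric coefficient matrices because
  quadrics and Gram matrices enter in this form. The equivalence is \<open>sym_indep_iff\<close>.
\<close>
definition sym_indep :: "nat \<Rightarrow> (nat \<Rightarrow> nat \<Rightarrow> 'a::real_vector) \<Rightarrow> bool" where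
  "sym_indep r v \<longleftrightarrow> (\<forall>A. (\<forall>i j. A i j = A j i) \<longrightarrow> (\<Sum>i<r. \<Sum>j<r. A i j *\<^sub>R v i j) = 0 \<longrightarrow>
     (\<forall>i<r. \<forall>j<r. A i j = 0))"

lemma sym_indepD:
  assumes "sym_indep r v" "\<And>i j. A i j = A j i" "(\<Sum>i<r. \<Sum>j<r. A i j *\<^sub>R v i j) = 0" "i < r" "j < r"
  shows "A i j = 0"
  using assms unfolding sym_indep_def by blast

definition upper :: "nat \<Rightarrow> (nat \<times> nat) set" where
  "upper r = {(i, j). i \<le> j \<and> j < r}"

lemma finite_upper: "finite (upper r)"
  by (rule finite_subset[of _ "{..<r} \<times> {..<r}"]) (auto simp: upper_def)

lemma sum_symmetric:
  fixes g :: "nat \<Rightarrow> nat \<Rightarrow> 'a::real_vector"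
  assumes sym: "\<And>i j. g i j = g j i"
  shows "(\<Sum>i<r. \<Sum>j<r. g i j) = (\<Sum>(i, j)\<in>upper r. (if i = j then 1 else 2) *\<^sub>R g i j)"
proof (induction r)
  case 0
  then show ?case by (simp add: upper_def)
next
  case (Suc r)
  have "upper (Suc r) = upper r \<union> (\<lambda>i. (i, r)) ` {..<r} \<union> {(r, r)}"
    by (auto simp: upper_def)
  moreover have "(\<Sum>(i, j)\<in>upper r \<union> (\<lambda>i. (i, r)) ` {..<r} \<union> {(r, r)}. (if i = j then 1 else 2) *\<^sub>R g i j)
      = (\<Sum>(i, j)\<in>upper r. (if i = j then 1 else 2) *\<^sub>R g i j)
      + (\<Sum>(i, j)\<in>(\<lambda>i. (i, r)) ` {..<r}. (if i = j then 1 else 2) *\<^sub>R g i j) + g r r"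
  proof -
    have "upper r \<inter> (\<lambda>i. (i, r)) ` {..<r} = {}" "(r, r) \<notin> upper r \<union> (\<lambda>i. (i, r)) ` {..<r}"
      by (auto simp: upper_def)
    then show ?thesis
      by (subst sum.union_disjoint; simp add: finite_upper sum.union_disjoint)
  qed
  moreover have "(\<Sum>(i, j)\<in>(\<lambda>i. (i, r)) ` {..<r}. (if i = j then 1 else 2) *\<^sub>R g i j)
      = (\<Sum>i<r. g i r) + (\<Sum>j<r. g r j)"
  proof -
    have "inj_on (\<lambda>i. (i, r)) {..<r}"
      by (auto intro: inj_onI)
    then show ?thesis
      by (simp add: sum.reindex scaleR_2 sum.distrib sym[of r])
  qed
  ultimately show ?case
    using Suc.IH by (simp add: sum.distrib add.assoc)
qed

lemma sym_indep_iff: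
  assumes sym: "\<And>i j. v i j = v j i"
  shows "sym_indep r v \<longleftrightarrow> indep_family (upper r) (\<lambda>(i, j). v i j)"
proof
  assume s: "sym_indep r v"
  show "indep_family (upper r) (\<lambda>(i, j). v i j)"
    unfolding indep_family_def
  proof (intro allI impI)
    fix c :: "nat \<times> nat \<Rightarrow> real"
    assume c: "(\<Sum>k\<in>upper r. c k *\<^sub>R (case k of (i, j) \<Rightarrow> v i j)) = 0"
    define A where "A = (\<lambda>i j. if i = j then c (i, i) else c (min i j, max i j) / 2)"
    have A: "A i j = A j i" for i j
      by (simp add: A_def min.commute max.commute)
    have "(\<Sum>i<r. \<Sum>j<r. A i j *\<^sub>R v i j) = (\<Sum>(i, j)\<in>upper r. (if i = j then 1 else 2) *\<^sub>R (A i j *\<^sub>R v i j))"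
    proof (rule sum_symmetric)
      show "A i j *\<^sub>R v i j = A j i *\<^sub>R v j i" for i j
        using A[of i j] sym[of i j] by simp
    qed
    also have "\<dots> = (\<Sum>k\<in>upper r. c k *\<^sub>R (case k of (i, j) \<Rightarrow> v i j))"
      by (rule sum.cong) (auto simp: upper_def A_def)
    finally have "\<forall>i<r. \<forall>j<r. A i j = 0"
      using s c A unfolding sym_indep_def by simp
    then have "A i j = 0" if "i \<le> j" "j < r" for i j
      using that by simp
    then have "c (i, j) = 0" if "i \<le> j" "j < r" for i j
      using that by (fastforce simp: A_def split: if_splits)
    then show "\<forall>k\<in>upper r. c k = 0"
      by (auto simp: upper_def)
  qed
next
  assume i: "indep_family (upper r) (\<lambda>(i, j). v i j)"
  show "sym_indep r v"
    unfolding sym_indep_def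
  proof (intro allI impI)
    fix A :: "nat \<Rightarrow> nat \<Rightarrow> real" and i j
    assume A: "\<forall>i j. A i j = A j i" "(\<Sum>i<r. \<Sum>j<r. A i j *\<^sub>R v i j) = 0" and ij: "i < r" "j < r"
    define c where "c = (\<lambda>(i, j). (if i = j then 1 else 2) * A i j)"
    have "(\<Sum>i<r. \<Sum>j<r. A i j *\<^sub>R v i j) = (\<Sum>(i, j)\<in>upper r. (if i = j then 1 else 2) *\<^sub>R (A i j *\<^sub>R v i j))"
    proof (rule sum_symmetric)
      show "A i j *\<^sub>R v i j = A j i *\<^sub>R v j i" for i j
        using A(1)[rule_format, of i j] sym[of i j] by simp
    qed
    also have "\<dots> = (\<Sum>k\<in>upper r. c k *\<^sub>R (case k of (i, j) \<Rightarrow> v i j))"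
      by (rule sum.cong) (auto simp: c_def)
    finally have "\<forall>k\<in>upper r. c k = 0"
      using i A(2) unfolding indep_family_def by simp
    then have "c (min i j, max i j) = 0"
      using ij by (simp add: upper_def)
    then show "A i j = 0"
      using A(1) by (auto simp: c_def min_def max_def split: if_splits)
  qed
qed

text \<open>
  In geometric terms, the curve parametrized by \<open>p\<close> lies on no quadric.
\<close>
definition qindep :: "nat \<Rightarrow> (nat \<Rightarrow> bipoly) \<Rightarrow> bool" where
  "qindep r p \<longleftrightarrow> sym_indep r (\<lambda>i j. p i * p j)"

lemma qindep_iff: "qindep r p \<longleftrightarrow> indep_family (upper r) (\<lambda>(i, j). p i * p j)"
  unfolding qindep_def by (rule sym_indep_iff) (rule mult.commute)

text \<open>
  A linear relation with coefficients \<open>c\<close> would give the quadratic relation with the rank one matrix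
  \<open>c i * c j\<close>.
\<close>
lemma qindep_imp_indep:
  assumes "qindep r p"
  shows "indep_family {..<r} p"
  unfolding indep_family_def
proof (intro allI impI ballI)
  fix c i assume c: "(\<Sum>i<r. c i *\<^sub>R p i) = 0" and i: "i \<in> {..<r}"
  have "(\<Sum>i<r. \<Sum>j<r. (c i * c j) *\<^sub>R (p i * p j)) = (\<Sum>i<r. c i *\<^sub>R p i) * (\<Sum>j<r. c j *\<^sub>R p j)"
    by (simp only: sum_product scaleR_mult_scaleR_bipoly)
  then have "c i * c i = 0"
    using c i by (intro sym_indepD[OF assms[unfolded qindep_def], where A = "\<lambda>i j. c i * c j"])
      (simp_all only: mult_zero_left lessThan_iff mult.commute)
  then show "c i = 0"
    by simp
qed

lemma tensor_sum_scaleR: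
  "tensor (\<Sum>i\<in>I. a i *\<^sub>R p i) (\<Sum>j\<in>J. b j *\<^sub>R q j) = (\<Sum>i\<in>I. \<Sum>j\<in>J. (a i * b j) *\<^sub>R tensor (p i) (q j))"
proof (rule poly_mapping_eqI)
  fix k :: "(nat \<times> nat) \<times> (nat \<times> nat)"
  obtain x y where "k = (x, y)"
    by (cases k)
  then show "coef (tensor (\<Sum>i\<in>I. a i *\<^sub>R p i) (\<Sum>j\<in>J. b j *\<^sub>R q j)) k
      = coef (\<Sum>i\<in>I. \<Sum>j\<in>J. (a i * b j) *\<^sub>R tensor (p i) (q j)) k"
    by (simp add: lookup_tensor lookup_sum lookup_scaleR_pm sum_product mult_ac)
qed

text \<open>
  Separates the identity from the Gram matrix of the coefficient vectors; it is applied both to the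
  products and to the tensors of the same forms.
\<close>
lemma sum_gram_matrix:
  fixes w :: "nat \<Rightarrow> nat \<Rightarrow> 'a::real_vector" and c :: "nat \<Rightarrow> nat \<Rightarrow> real"
  defines "A \<equiv> \<lambda>n i j. (\<Sum>k<n. c k i * c k j) - of_bool (i = j)"
  shows "(\<Sum>k<n. \<Sum>i<r. \<Sum>j<r. (c k i * c k j) *\<^sub>R w i j) = (\<Sum>i<r. w i i) + (\<Sum>i<r. \<Sum>j<r. A n i j *\<^sub>R w i j)"
proof -
  have "(\<Sum>k<n. \<Sum>i<r. \<Sum>j<r. (c k i * c k j) *\<^sub>R w i j) = (\<Sum>i<r. \<Sum>k<n. \<Sum>j<r. (c k i * c k j) *\<^sub>R w i j)"
    by (rule sum.swap)
  also have "\<dots> = (\<Sum>i<r. \<Sum>j<r. (\<Sum>k<n. c k i * c k j) *\<^sub>R w i j)"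
    by (rule sum.cong[OF refl], subst sum.swap) (simp only: scaleR_sum_left)
  also have "\<dots> = (\<Sum>i<r. \<Sum>j<r. of_bool (i = j) *\<^sub>R w i j) + (\<Sum>i<r. \<Sum>j<r. A n i j *\<^sub>R w i j)"
    by (simp add: A_def sum.distrib[symmetric] scaleR_add_left[symmetric])
  also have "(\<Sum>i<r. \<Sum>j<r. of_bool (i = j) *\<^sub>R w i j) = (\<Sum>i<r. w i i)"
  proof (rule sum.cong[OF refl])
    fix i assume "i \<in> {..<r}"
    then show "(\<Sum>j<r. of_bool (i = j) *\<^sub>R w i j) = w i i"
      by (simp add: of_bool_def if_distrib[of "\<lambda>x. x *\<^sub>R _"] cong: if_cong)
  qed
  finally show ?thesis .
qed

text \<open>
  Expressed in the \<open>p i\<close>, both tensors have Gram matrices with the same image under multiplication.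
  The difference of the two matrices is therefore a quadratic relation between the \<open>p i\<close>.
\<close>
lemma Gram_unique_in_span:
  assumes q: "qindep r p" and span: "\<And>k. k < (n::nat) \<Longrightarrow> s k \<in> span (p ` {..<r})"
    and eq: "(\<Sum>k<n. (s k)\<^sup>2) = (\<Sum>i<r. (p i)\<^sup>2)"
  shows "(\<Sum>k<n. tensor (s k) (s k)) = (\<Sum>i<r. tensor (p i) (p i))"
proof -
  note inj = indep_family_independent(1)[OF finite_lessThan qindep_imp_indep[OF q]]
  have "\<exists>c. k < n \<longrightarrow> s k = (\<Sum>i<r. c i *\<^sub>R p i)" for k
  proof (cases "k < n")
    case True
    then obtain u where "s k = (\<Sum>v\<in>p ` {..<r}. u v *\<^sub>R v)"
      using span[OF True] by (auto simp: span_finite)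
    then have "s k = (\<Sum>i<r. u (p i) *\<^sub>R p i)"
      by (simp add: sum.reindex[OF inj])
    then show ?thesis
      by (intro exI[of _ "\<lambda>i. u (p i)"]) simp
  qed simp
  then obtain c where c: "\<And>k. k < n \<Longrightarrow> s k = (\<Sum>i<r. c k i *\<^sub>R p i)"
    by metis
  define A where "A = (\<lambda>i j. (\<Sum>k<n. c k i * c k j) - of_bool (i = j))"
  have "(\<Sum>k<n. (s k)\<^sup>2) = (\<Sum>k<n. \<Sum>i<r. \<Sum>j<r. (c k i * c k j) *\<^sub>R (p i * p j))"
    by (rule sum.cong) (simp_all add: c power2_eq_square sum_product scaleR_mult_scaleR_bipoly)
  then have "(\<Sum>i<r. \<Sum>j<r. A i j *\<^sub>R (p i * p j)) = 0"
    using eq sum_gram_matrix[where c = c and n = n and r = r and w = "\<lambda>i j. p i * p j"]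
    by (simp add: A_def power2_eq_square)
  moreover have "\<forall>i j. A i j = A j i"
    by (simp add: A_def mult.commute)
  ultimately have A0: "\<forall>i<r. \<forall>j<r. A i j = 0"
    using sym_indepD[OF q[unfolded qindep_def], of A] by blast
  have "(\<Sum>k<n. tensor (s k) (s k)) = (\<Sum>k<n. \<Sum>i<r. \<Sum>j<r. (c k i * c k j) *\<^sub>R tensor (p i) (p j))"
    by (rule sum.cong) (simp_all add: c tensor_sum_scaleR)
  also have "\<dots> = (\<Sum>i<r. tensor (p i) (p i))"
    using A0 sum_gram_matrix[where c = c and n = n and r = r and w = "\<lambda>i j. tensor (p i) (p j)"]
    by (simp add: A_def)
  finally show ?thesis .
qed

lemma linear_functional_separating:
  fixes x :: "'a::real_vector"
  assumes "x \<notin> span S" "independent S"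
  shows "\<exists>l :: 'a \<Rightarrow> real. linear l \<and> (\<forall>s\<in>S. l s = 0) \<and> l x \<noteq> 0"
proof -
  have "independent (insert x S)"
    using assms by (rule independent_insertI)
  then obtain l :: "'a \<Rightarrow> real" where l: "linear l" "\<forall>s\<in>insert x S. l s = of_bool (s = x)"
    using linear_independent_extend[of "insert x S" "\<lambda>s. of_bool (s = x)"] by blast
  have "x \<notin> S"
    using assms(1) span_base by metis
  then have "\<forall>s\<in>S. l s = 0" "l x \<noteq> 0"
    using l(2) by auto
  then show ?thesis
    using l(1) by blast
qed

text \<open>
  A functional \<open>l\<close> that vanishes on all \<open>p i\<close> makes the quadratic form \<open>l \<otimes> l\<close> vanish on the left side.
  On the right side it gives a sum of nonnegative terms \<open>(l (s k))\<^sup>2\<close> and \<open>(l (t k))\<^sup>2\<close>, so all those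
  with positive weight vanish. Functionals that vanish on a span separate it from other vectors.
\<close>
lemma psd_summand_in_span:
  assumes p: "independent (p ` {..<r::nat})" and u: "0 < u" "0 \<le> v"
    and eq: "(\<Sum>i<r. tensor (p i) (p i)) = u *\<^sub>R (\<Sum>k<m::nat. tensor (s k) (s k)) + v *\<^sub>R (\<Sum>k<n::nat. tensor (t k) (t k))"
    and k: "k < m"
  shows "s k \<in> span (p ` {..<r})"
proof (rule ccontr)
  assume "s k \<notin> span (p ` {..<r})"
  with p obtain l :: "bipoly \<Rightarrow> real" where l: "linear l" "\<forall>x\<in>p ` {..<r}. l x = 0" "l (s k) \<noteq> 0"
    using linear_functional_separating by blast
  have ev: "l (contract l (\<Sum>k<m. tensor (s k) (s k))) = (\<Sum>k<m. (l (s k))\<^sup>2)" for m :: nat and s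
    by (simp only: linear_sum[OF linear_contract] contract_tensor[OF l(1)] linear_sum[OF l(1)]
        linear_cmul[OF l(1)] power2_eq_square real_scaleR_def)
  have "(\<Sum>i<r. (l (p i))\<^sup>2) = u * (\<Sum>k<m. (l (s k))\<^sup>2) + v * (\<Sum>k<n. (l (t k))\<^sup>2)"
    using arg_cong[OF eq, of "\<lambda>\<theta>. l (contract l \<theta>)"]
    by (simp only: ev linear_add[OF linear_contract] linear_cmul[OF linear_contract] linear_add[OF l(1)]
        linear_cmul[OF l(1)] real_scaleR_def)
  moreover have "(\<Sum>i<r. (l (p i))\<^sup>2) = 0"
    using l(2) by simp
  moreover have "(l (s k))\<^sup>2 \<le> (\<Sum>k<m. (l (s k))\<^sup>2)"
    using k by (intro member_le_sum) auto
  then have "0 < (\<Sum>k<m. (l (s k))\<^sup>2)"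
    by (rule order_less_le_trans[rotated]) (simp add: l(3))
  then have "0 < u * (\<Sum>k<m. (l (s k))\<^sup>2)"
    using u(1) by simp
  moreover have "0 \<le> v * (\<Sum>k<n. (l (t k))\<^sup>2)"
    using u(2) by (simp add: sum_nonneg)
  ultimately show False
    by linarith
qed

text \<open>
  Both end points of a segment through the tensor are sums of squares over the span of the \<open>p i\<close>, where
  the Gram tensor of a given form is unique.
\<close>
theorem qindep_extreme_point:
  assumes q: "qindep r p" and p: "\<And>i. i < r \<Longrightarrow> p i \<in> forms d"
  shows "(\<Sum>i<r. tensor (p i) (p i)) extreme_point_of Gram d (\<Sum>i<r. (p i)\<^sup>2)"
    and "tensor_rank (\<Sum>i<r. tensor (p i) (p i)) = r"
proof -
  let ?\<theta> = "\<Sum>i<r. tensor (p i) (p i)" and ?f = "\<Sum>i<r. (p i)\<^sup>2"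
  note ind = indep_family_independent[OF finite_lessThan qindep_imp_indep[OF q]]
  show "tensor_rank ?\<theta> = r"
    by (rule tensor_rank_sum[OF ind])
  have mult: "mult_map (\<Sum>k<n. tensor (s k) (s k)) = (\<Sum>k<n. (s k)\<^sup>2)" for n :: nat and s
    by (simp add: linear_sum[OF linear_mult_map] mult_map_tensor power2_eq_square)
  have mem: "?\<theta> \<in> Gram d ?f"
    using p by (auto simp: Gram_def psd_tensors_eq mult)
  have unique: "\<alpha> = ?\<theta>"
    if \<alpha>: "\<alpha> \<in> Gram d ?f" and \<beta>: "\<beta> \<in> Gram d ?f" and uv: "0 < u" "0 \<le> v" "?\<theta> = u *\<^sub>R \<alpha> + v *\<^sub>R \<beta>" for \<alpha> \<beta> u v
  proof -
    obtain m :: nat and s where s: "\<alpha> = (\<Sum>k<m. tensor (s k) (s k))"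
      using \<alpha> by (auto simp: Gram_def psd_tensors_eq)
    obtain n :: nat and t where t: "\<beta> = (\<Sum>k<n. tensor (t k) (t k))"
      using \<beta> by (auto simp: Gram_def psd_tensors_eq)
    show ?thesis
      unfolding s
    proof (rule Gram_unique_in_span[OF q])
      show "s k \<in> span (p ` {..<r})" if "k < m" for k
        by (rule psd_summand_in_span[OF ind(2) uv(1,2) uv(3)[unfolded s t] that])
      show "(\<Sum>k<m. (s k)\<^sup>2) = ?f"
        using \<alpha> by (simp add: Gram_def s mult)
    qed
  qed
  show "?\<theta> extreme_point_of Gram d ?f"
    unfolding extreme_point_of_def
  proof (intro conjI ballI notI)
    fix \<alpha> \<beta> assume ab: "\<alpha> \<in> Gram d ?f" "\<beta> \<in> Gram d ?f" and "?\<theta> \<in> open_segment \<alpha> \<beta>"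
    then obtain u where u: "\<alpha> \<noteq> \<beta>" "0 < u" "u < 1" "?\<theta> = (1 - u) *\<^sub>R \<alpha> + u *\<^sub>R \<beta>"
      by (auto simp: in_segment)
    have "\<alpha> = ?\<theta>"
      by (rule unique[OF ab, of "1 - u" u]) (use u in auto)
    moreover have "\<beta> = ?\<theta>"
      by (rule unique[OF ab(2,1), of u "1 - u"]) (use u in \<open>auto simp: add.commute\<close>)
    ultimately show False
      using u(1) by simp
  qed (rule mem)
qed

section \<open>Nonnegative binary forms are sums of two squares\<close>

lemma map_poly_of_real_add_mult:
  "map_poly complex_of_real (p + q) = map_poly of_real p + map_poly of_real q"
  "map_poly complex_of_real (p * q) = map_poly of_real p * map_poly of_real q"
  by (intro poly_eqI; simp add: coeff_map_poly coeff_mult)+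

text \<open>
  A real root is a minimum, so the derivative vanishes there as well.
\<close>
lemma nonneg_poly_double_root:
  fixes F :: "real poly"
  assumes nonneg: "\<And>x. 0 \<le> poly F x" and root: "poly F a = 0"
  obtains H where "F = [:- a, 1:]\<^sup>2 * H" "\<And>x. 0 \<le> poly H x"
proof -
  obtain G where G: "F = [:- a, 1:] * G"
    using root by (auto simp: poly_eq_0_iff_dvd)
  have "poly (pderiv F) a = 0"
    by (rule DERIV_local_min[OF poly_DERIV, of 1]) (use assms in auto)
  then have "poly G a = 0"
    unfolding G pderiv_mult by (simp add: pderiv_pCons)
  then obtain H where H: "G = [:- a, 1:] * H"
    by (auto simp: poly_eq_0_iff_dvd)
  have F: "F = [:- a, 1:]\<^sup>2 * H"
    unfolding G H power2_eq_square by (simp only: mult.assoc)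
  have off: "0 \<le> poly H x" if "x \<noteq> a" for x
  proof -
    have "0 \<le> (x - a)\<^sup>2 * poly H x"
      using nonneg[of x] by (simp add: F)
    then show ?thesis
      using that by (simp add: zero_le_mult_iff)
  qed
  have "0 \<le> poly H a"
  proof (rule tendsto_lowerbound)
    show "(poly H \<longlongrightarrow> poly H a) (at a)"
      by (intro tendsto_intros)
    show "\<forall>\<^sub>F x in at a. 0 \<le> poly H x"
      using off by (auto simp: eventually_at intro: exI[of _ 1])
  qed simp
  then show thesis
    using that[OF F] off by metis
qed

text \<open>
  The divisor is \<open>(x - z) (x - cnj z)\<close>, written as a sum of two squares. The remainder of the division is
  a real polynomial of degree at most one with a root off the real line, hence zero.
\<close>
lemma real_poly_conjugate_roots:
  fixes F :: "real poly"
  assumes root: "poly (map_poly complex_of_real F) z = 0" and im: "Im z \<noteq> 0"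
  shows "([:- Re z, 1:]\<^sup>2 + [:Im z:]\<^sup>2) dvd F"
proof -
  let ?D = "[:- Re z, 1:]\<^sup>2 + [:Im z:]\<^sup>2"
  have D: "?D = [:(Re z)\<^sup>2 + (Im z)\<^sup>2, - 2 * Re z, 1:]"
    by (simp add: power2_eq_square)
  have deg: "degree ?D = 2"
    unfolding D by simp
  have "degree (F mod ?D) < 2"
    using degree_mod_less'[of ?D F] deg by (cases "F mod ?D = 0") auto
  then have r: "F mod ?D = [:coeff (F mod ?D) 0, coeff (F mod ?D) 1:]"
    by (intro poly_eqI) (auto simp: coeff_pCons coeff_eq_0 split: nat.split)
  have "poly (map_poly complex_of_real ?D) z = 0"
    unfolding D by (simp add: map_poly_pCons complex_eq_iff power2_eq_square algebra_simps)
  moreover have "F = ?D * (F div ?D) + F mod ?D"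
    by simp
  ultimately have "poly (map_poly complex_of_real (F mod ?D)) z = 0"
    using root by (metis add_0 map_poly_of_real_add_mult mult_zero_left poly_add poly_mult)
  then have "coeff (F mod ?D) 1 = 0" "coeff (F mod ?D) 0 = 0"
    using im by (subst (asm) r; auto simp: map_poly_pCons complex_eq_iff)+
  then have "F mod ?D = 0"
    by (subst r) simp
  then show ?thesis
    by (simp add: mod_eq_0_iff_dvd)
qed

text \<open>
  Split off double real roots and pairs of conjugate roots. The latter contribute a factor that is
  itself a sum of two squares, and a product of two sums of two squares is again one.
\<close>
theorem nonneg_poly_sum_two_squares:
  fixes F :: "real poly"
  assumes "\<And>x. 0 \<le> poly F x"
  shows "\<exists>P Q. F = P\<^sup>2 + Q\<^sup>2"
  using assms
proof (induction "degree F" arbitrary: F rule: less_induct)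
  case less
  show ?case
  proof (cases "degree F = 0")
    case True
    then obtain c where c: "F = [:c:]"
      using degree_eq_zeroE by blast
    then have "F = [:sqrt c:]\<^sup>2 + 0\<^sup>2"
      using less.prems[of 0] by (simp add: power2_eq_square)
    then show ?thesis
      by blast
  next
    case False
    then have "degree (map_poly complex_of_real F) \<noteq> 0"
      by (simp add: degree_map_poly)
    then obtain z where z: "poly (map_poly complex_of_real F) z = 0"
      using fundamental_theorem_of_algebra[of "map_poly complex_of_real F"]
      by (auto simp: constant_degree)
    show ?thesis
    proof (cases "Im z = 0")
      case True
      then have "z = of_real (Re z)"
        by (simp add: complex_eq_iff)
      moreover have "poly (map_poly complex_of_real F) (of_real (Re z)) = of_real (poly F (Re z))"
        by (induction F) (simp_all add: map_poly_pCons)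
      ultimately have "poly F (Re z) = 0"
        using z by (metis of_real_eq_0_iff)
      then obtain H where H: "F = [:- Re z, 1:]\<^sup>2 * H" "\<And>x. 0 \<le> poly H x"
        using nonneg_poly_double_root less.prems by blast
      have "H \<noteq> 0"
        using False H(1) by auto
      then have "degree H < degree F"
        by (simp add: H(1) degree_mult_eq degree_power_eq)
      then obtain P Q where "H = P\<^sup>2 + Q\<^sup>2"
        using less.hyps H(2) by blast
      then have "F = ([:- Re z, 1:] * P)\<^sup>2 + ([:- Re z, 1:] * Q)\<^sup>2"
        unfolding H(1) by algebra
      then show ?thesis
        by blast
    next
      case False
      let ?A = "[:- Re z, 1:]" and ?B = "[:Im z:]"
      obtain H where H: "F = (?A\<^sup>2 + ?B\<^sup>2) * H"
        using real_poly_conjugate_roots[OF z False] by (auto simp: dvd_def)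
      have pos: "0 < poly (?A\<^sup>2 + ?B\<^sup>2) x" for x
        using False by (simp add: add_nonneg_pos)
      have "0 \<le> poly H x" for x
        using less.prems[of x] pos[of x] unfolding H poly_mult by (simp only: zero_le_mult_iff) linarith
      moreover have "degree H < degree F"
      proof -
        have "degree (?A\<^sup>2 + ?B\<^sup>2) = 2"
          by (simp add: power2_eq_square)
        moreover have "H \<noteq> 0"
          using \<open>degree F \<noteq> 0\<close> H by auto
        moreover have "?A\<^sup>2 + ?B\<^sup>2 \<noteq> 0"
          using calculation(1) by auto
        ultimately show ?thesis
          by (simp only: H degree_mult_eq not_False_eq_True)
      qed
      ultimately obtain P Q where "H = P\<^sup>2 + Q\<^sup>2"
        using less.hyps by blast
      then have "F = (?A * P - ?B * Q)\<^sup>2 + (?A * Q + ?B * P)\<^sup>2"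
        unfolding H by algebra
      then show ?thesis
        by blast
    qed
  qed
qed

text \<open>
  The leading coefficients of two squares are nonnegative and cannot cancel.
\<close>
lemma degree_le_of_sum_squares:
  fixes P Q :: "real poly"
  assumes "degree (P\<^sup>2 + Q\<^sup>2) \<le> 2 * d"
  shows "degree P \<le> d"
proof (rule ccontr)
  assume "\<not> degree P \<le> d"
  \<comment> \<open>the coefficients of order \<open>n\<close> are the leading ones of at least one of the two\<close>
  define n where "n = max (degree P) (degree Q)"
  have coeff: "coeff (R\<^sup>2) (2 * n) = (coeff R n)\<^sup>2" if "degree R \<le> n" for R :: "real poly"
  proof (cases "degree R = n")
    case True
    then show ?thesis
      using coeff_mult_degree_sum[of R R] by (simp add: power2_eq_square mult_2)
  next
    case False
    then have "degree R < n"
      using that by simp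
    moreover have "degree (R\<^sup>2) \<le> 2 * degree R"
      using degree_power_le[of R 2] by (simp add: mult.commute)
    ultimately show ?thesis
      by (simp add: coeff_eq_0)
  qed
  have "coeff (P\<^sup>2 + Q\<^sup>2) (2 * n) = 0"
    using assms \<open>\<not> degree P \<le> d\<close> by (intro coeff_eq_0) (simp add: n_def)
  then have "(coeff P n)\<^sup>2 + (coeff Q n)\<^sup>2 = 0"
    using coeff[of P] coeff[of Q] by (simp add: n_def)
  then have "coeff P n = 0" "coeff Q n = 0"
    by (simp_all add: sum_power2_eq_zero_iff)
  then have "P = 0 \<or> degree P < n" "Q = 0 \<or> degree Q < n"
    using n_def by (metis leading_coeff_0_iff le_neq_implies_less max.cobounded1 max.cobounded2)+
  then show False
    using \<open>\<not> degree P \<le> d\<close> by (auto simp: n_def)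
qed

lemma sos_cone_two_squares:
  assumes "f \<in> sos_cone d"
  obtains p q where "p \<in> forms d" "q \<in> forms d" "f = p\<^sup>2 + q\<^sup>2"
proof -
  obtain r :: nat and p where p: "\<And>i. i < r \<Longrightarrow> p i \<in> forms d" "f = (\<Sum>i<r. (p i)\<^sup>2)"
    using assms unfolding sos_cone_def by blast
  have "\<forall>i. \<exists>P. i < r \<longrightarrow> degree P \<le> d \<and> p i = homogenize d P"
    using p(1) forms_homogenizeE by metis
  then obtain P where P: "\<And>i. i < r \<Longrightarrow> degree (P i) \<le> d" "\<And>i. i < r \<Longrightarrow> p i = homogenize d (P i)"
    by metis
  define F where "F = (\<Sum>i<r. (P i)\<^sup>2)"
  have f: "f = homogenize (2 * d) F"
    unfolding F_def p(2) homogenize_sum using P by (intro sum.cong) (auto simp: homogenize_square)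
  have "degree F \<le> 2 * d"
    unfolding F_def
  proof (rule degree_sum_le)
    show "degree ((P i)\<^sup>2) \<le> 2 * d" if "i \<in> {..<r}" for i
      using degree_power_le[of "P i" 2] P(1)[of i] that by simp
  qed simp
  moreover obtain A B where AB: "F = A\<^sup>2 + B\<^sup>2"
    using nonneg_poly_sum_two_squares[of F] by (auto simp: F_def poly_sum sum_nonneg)
  ultimately have deg: "degree A \<le> d" "degree B \<le> d"
    using degree_le_of_sum_squares[of A B d] degree_le_of_sum_squares[of B A d] by (auto simp: add.commute)
  show thesis
  proof (rule that)
    show "f = (homogenize d A)\<^sup>2 + (homogenize d B)\<^sup>2"
      using deg by (simp add: f AB homogenize_add homogenize_square)
  qed (rule homogenize_in_forms)+
qed

section \<open>Chains of vectors that determine a quadric\<close>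

definition bil :: "nat \<Rightarrow> (nat \<Rightarrow> nat \<Rightarrow> real) \<Rightarrow> (nat \<Rightarrow> real) \<Rightarrow> (nat \<Rightarrow> real) \<Rightarrow> real" where
  "bil r B u v = (\<Sum>i<r. \<Sum>j<r. B i j * u i * v j)"

text \<open>
  Geometrically, no quadric contains the chain of lines through consecutive points \<open>us ! k\<close>. With \<open>d + 1\<close> points these are \<open>2 d + 1\<close> linear conditions on a
  symmetric matrix of size \<open>r\<close>.
\<close>
definition chain_determines :: "nat \<Rightarrow> (nat \<Rightarrow> real) list \<Rightarrow> bool" where
  "chain_determines r us \<longleftrightarrow>
    (\<forall>B. (\<forall>i j. B i j = B j i) \<longrightarrow> (\<forall>u\<in>set us. bil r B u u = 0) \<longrightarrow>
      successively (\<lambda>u v. bil r B u v = 0) us \<longrightarrow> (\<forall>i<r. \<forall>j<r. B i j = 0))"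

text \<open>
  The vector \<open>e\<^sub>a + e\<^sub>b / 4\<close> for a pair \<open>(a, b)\<close>. If the diagonal of \<open>B\<close> is known to vanish, the square of
  this vector gives the entry at \<open>(a, b)\<close>, while a product of two such vectors is the entry at the
  two first components up to a small error.
\<close>
definition tilt :: "nat \<times> nat \<Rightarrow> nat \<Rightarrow> real" where
  "tilt p i = of_bool (i = fst p) + of_bool (i = snd p) / 4"

lemma sum_mult_tilt:
  assumes "fst p < n" "snd p < n"
  shows "(\<Sum>i<n. f i * tilt p i) = f (fst p) + f (snd p) / 4"
  using assms by (simp add: tilt_def distrib_left sum.distrib of_bool_def if_distrib[of "(*) _"]
      if_distrib[of "\<lambda>x. x / _"] sum.delta cong: if_cong)

lemma bil_tilt:
  assumes "fst p < n" "snd p < n" "fst q < n" "snd q < n"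
  shows "bil n B (tilt p) (tilt q) = B (fst p) (fst q) + B (fst p) (snd q) / 4
     + B (snd p) (fst q) / 4 + B (snd p) (snd q) / 16"
proof -
  have "bil n B (tilt p) (tilt q) = (\<Sum>i<n. (\<Sum>j<n. B i j * tilt q j) * tilt p i)"
    unfolding bil_def by (simp add: sum_distrib_right sum_distrib_left mult_ac)
  also have "\<dots> = B (fst p) (fst q) + B (fst p) (snd q) / 4
     + (B (snd p) (fst q) + B (snd p) (snd q) / 4) / 4"
    using assms by (simp only: sum_mult_tilt)
  finally show ?thesis
    by (simp add: field_simps)
qed

fun trail :: "'a list \<Rightarrow> ('a \<times> 'a) set" where
  "trail (a # b # as) = insert (a, b) (trail (b # as))"
| "trail _ = {}"

lemma trail_append_subset: "trail xs \<union> trail ys \<subseteq> trail (xs @ ys)"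
  by (induction xs rule: trail.induct) (auto, (cases ys, auto)+)

lemma successively_trail:
  assumes "successively R ps" "(a, b) \<in> trail (map f ps)"
  shows "\<exists>p\<in>set ps. \<exists>q\<in>set ps. f p = a \<and> f q = b \<and> R p q"
  using assms by (induction ps rule: trail.induct) auto

text \<open>
  Let \<open>M\<close> be the largest absolute value of an entry. An edge condition expresses the entry on that edge
  through three other entries with weights \<open>1/4\<close>, \<open>1/4\<close> and \<open>1/16\<close>, so all entries are bounded by
  \<open>9/16 * M\<close>, which is possible for \<open>M = 0\<close> only. The small multiple in \<open>tilt\<close> was chosen for this.
\<close>
lemma trail_contraction:
  assumes sym: "\<And>i j. B i j = B j i"
    and range: "set xs \<subseteq> {..<n} \<times> {..<n}"
    and zero: "\<And>i j. i < n \<Longrightarrow> j < n \<Longrightarrow> B i j = 0 \<or> (i, j) \<in> trail (map fst xs) \<or> (j, i) \<in> trail (map fst xs)"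
    and ortho: "successively (\<lambda>p q. bil n B (tilt p) (tilt q) = 0) xs"
    and ij: "i < n" "j < n"
  shows "B i j = 0"
proof -
  define M where "M = Max ((\<lambda>(i, j). \<bar>B i j\<bar>) ` ({..<n} \<times> {..<n}))"
  have M: "\<bar>B i j\<bar> \<le> M" if "i < n" "j < n" for i j
    unfolding M_def by (rule Max_ge) (use that in auto)
  have trail: "\<bar>B a b\<bar> \<le> 9 / 16 * M" if ab: "(a, b) \<in> trail (map fst xs)" for a b
  proof -
    obtain p q where pq: "p \<in> set xs" "q \<in> set xs" "fst p = a" "fst q = b"
      "bil n B (tilt p) (tilt q) = 0"
      using successively_trail[OF ortho ab] by blast
    have *: "fst p < n" "snd p < n" "fst q < n" "snd q < n"
      using range pq(1,2) by auto
    show ?thesis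
      using pq(5) M[OF *(1,4)] M[OF *(2,3)] M[OF *(2,4)]
      unfolding bil_tilt[OF *] pq(3,4) by linarith
  qed
  have "M \<in> (\<lambda>(i, j). \<bar>B i j\<bar>) ` ({..<n} \<times> {..<n})"
    unfolding M_def by (rule Max_in) (use ij in auto)
  then obtain a b where ab: "a < n" "b < n" "M = \<bar>B a b\<bar>"
    by auto
  then have "M \<le> 9 / 16 * M \<or> M = 0"
    using zero[OF ab(1,2)] trail[of a b] trail[of b a] sym[of a b] by auto
  then show ?thesis
    using M[OF ij] by auto
qed

text \<open>
  The table for the step from \<open>r\<close> to \<open>r + 4\<close>. The vertices \<open>0, \<dots>, \<rho> - 1\<close> stand for \<open>\<rho>\<close> of the old ones,
  \<open>\<rho>, \<dots>, \<rho> + 3\<close> for the new ones. A walk from the old vertex \<open>\<rho> - 1\<close> through the first components, together with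
  the listed pairs, has to cover the \<open>4 \<rho> + 10\<close> pairs that involve a new vertex. It makes
  \<open>2 \<rho> + 5\<close> steps, each of which yields one edge and one listed pair, so no pair may be covered
  twice. The tables solve this covering problem. It has no solution for \<open>\<rho> = 1\<close>, where
  an inner vertex of the walk lies on four edges only, which leaves no pair for a second visit. Hence \<open>\<rho>\<close> runs through \<open>2, \<dots>, 5\<close>.
\<close>
definition opening_walk :: "nat \<Rightarrow> (nat \<times> nat) list" where
  "opening_walk \<rho> =
    (if \<rho> = 2 then [(4, 4), (5, 5), (2, 2), (0, 5), (3, 3), (4, 0), (2, 1), (3, 1), (5, 1)]
     else if \<rho> = 3 then
       [(3, 3), (0, 4), (5, 5), (1, 6), (4, 4), (2, 5), (6, 6), (4, 3), (5, 6), (3, 1), (6, 0)]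
     else if \<rho> = 4 then
       [(4, 4), (5, 5), (6, 6), (2, 4), (5, 1), (0, 4), (7, 7), (1, 6), (4, 6), (7, 5), (3, 5),
        (6, 0), (7, 2)]
     else
       [(6, 6), (8, 8), (2, 5), (6, 1), (3, 7), (5, 5), (8, 0), (7, 7), (6, 5), (0, 5), (7, 2),
        (4, 8), (5, 7), (1, 7), (8, 3)])"

text \<open>
  The remaining old vertices come in groups \<open>v, \<dots>, v + 3\<close>. A closed walk of eight steps from and to the
  new vertex \<open>r + 3\<close>, alternating between the group and the new vertices, covers all sixteen pairs
  between them: eight as edges and eight as listed pairs.
\<close>
definition block :: "nat \<Rightarrow> nat \<Rightarrow> (nat \<times> nat) list" where
  "block r v = [(v, r + 1), (r, v + 2), (v + 1, r + 2), (r + 1, v + 3), (v + 2, r + 3),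
     (r + 2, v), (v + 3, r), (r + 3, v + 1)]"

text \<open>
  The shift by \<open>r - \<rho>\<close> lets the last \<open>\<rho>\<close> old vertices take part in the opening, so that the walk
  continues from the vertex \<open>r - 1\<close>, where the chain for \<open>r\<close> ends.
\<close>
fun walk :: "nat \<Rightarrow> nat \<Rightarrow> nat \<Rightarrow> (nat \<times> nat) list" where
  "walk r \<rho> 0 = map (\<lambda>(a, b). (a + (r - \<rho>), b + (r - \<rho>))) (opening_walk \<rho>)"
| "walk r \<rho> (Suc g) = walk r \<rho> g @ block r (4 * g)"

text \<open>
  The vertex \<open>z\<close> is the one from which the walk enters \<open>ps\<close>.
\<close>
definition covers :: "nat \<Rightarrow> (nat \<times> nat) list \<Rightarrow> nat \<Rightarrow> nat \<Rightarrow> bool" where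
  "covers z ps i j \<longleftrightarrow> (i, j) \<in> set ps \<union> trail (z # map fst ps) \<or> (j, i) \<in> set ps \<union> trail (z # map fst ps)"

lemma opening_walk_properties:
  assumes "\<rho> \<in> {2, 3, 4, 5}"
  shows "opening_walk \<rho> \<noteq> []" "length (opening_walk \<rho>) = 5 + 2 * \<rho>" "fst (last (opening_walk \<rho>)) = \<rho> + 3"
    "set (opening_walk \<rho>) \<subseteq> {..<\<rho> + 4} \<times> {..<\<rho> + 4}"
  using assms by (auto simp: opening_walk_def)

lemma opening_walk_covers:
  assumes "\<rho> \<in> {2, 3, 4, 5}" "\<rho> \<le> j" "j < \<rho> + 4"
  shows "(j, j) \<in> set (opening_walk \<rho>)" "i < \<rho> + 4 \<Longrightarrow> i \<noteq> j \<Longrightarrow> covers (\<rho> - 1) (opening_walk \<rho>) i j"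
proof -
  have "\<forall>\<rho>\<in>{2, 3, 4, 5}. \<forall>t\<in>{0, 1, 2, 3}. (\<rho> + t, \<rho> + t) \<in> set (opening_walk \<rho>) \<and>
    (\<forall>i\<in>{0, 1, 2, 3, 4, 5, 6, 7, 8}. i < \<rho> + 4 \<longrightarrow> i \<noteq> \<rho> + t \<longrightarrow> covers (\<rho> - 1) (opening_walk \<rho>) i (\<rho> + t))"
    by (simp add: opening_walk_def covers_def)
  moreover have "j - \<rho> \<in> {0, 1, 2, 3}" "\<rho> + (j - \<rho>) = j"
    using assms by auto
  moreover have "i \<in> {0, 1, 2, 3, 4, 5, 6, 7, 8}" if "i < \<rho> + 4"
    using that assms(1) by auto
  ultimately show "(j, j) \<in> set (opening_walk \<rho>)" "i < \<rho> + 4 \<Longrightarrow> i \<noteq> j \<Longrightarrow> covers (\<rho> - 1) (opening_walk \<rho>) i j"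
    using assms(1) by metis+
qed

text \<open>
  The square conditions give the entries at the listed pairs exactly: at a loop \<open>(j, j)\<close> a diagonal
  entry, and at \<open>(a, b)\<close> the entry there, because the diagonal is known. What is left are the edges of the walk,
  which \<open>trail_contraction\<close> handles.
\<close>
lemma bil_zero_of_covers:
  assumes sym: "\<And>i j. B i j = B j i"
    and range: "z < n" "w < n" "set ps \<subseteq> {..<n} \<times> {..<n}"
    and old: "\<And>i j. i < m \<Longrightarrow> j < m \<Longrightarrow> B i j = 0"
    and square: "\<And>p. p \<in> set ps \<Longrightarrow> bil n B (tilt p) (tilt p) = 0"
    and ortho: "successively (\<lambda>u v. bil n B u v = 0) (map tilt ((z, w) # ps))"
    and loop: "\<And>j. m \<le> j \<Longrightarrow> j < n \<Longrightarrow> (j, j) \<in> set ps"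
    and covers: "\<And>i j. m \<le> j \<Longrightarrow> j < n \<Longrightarrow> i < n \<Longrightarrow> i \<noteq> j \<Longrightarrow> covers z ps i j"
    and ij: "i < n" "j < n"
  shows "B i j = 0"
proof -
  have diag: "B i i = 0" if "i < n" for i
  proof (cases "i < m")
    case False
    then show ?thesis
      using square[OF loop[of i]] that by (simp add: bil_tilt)
  qed (use old in simp)
  have assigned: "B a b = 0" if "(a, b) \<in> set ps" for a b
  proof -
    have "a < n" "b < n"
      using that range(3) by auto
    then show ?thesis
      using square[OF that] diag[of a] diag[of b] sym[of a b] by (simp add: bil_tilt)
  qed
  have new: "B i j = 0 \<or> (i, j) \<in> trail (z # map fst ps) \<or> (j, i) \<in> trail (z # map fst ps)"
    if "m \<le> j" "i < n" "j < n" for i j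
    using covers[of j i] that assigned[of i j] assigned[of j i] diag[of i] sym[of i j]
    unfolding covers_def by auto
  show ?thesis
  proof (rule trail_contraction[where n = n and B = B and xs = "(z, w) # ps"])
    show "B i j = 0 \<or> (i, j) \<in> trail (map fst ((z, w) # ps)) \<or> (j, i) \<in> trail (map fst ((z, w) # ps))"
      if "i < n" "j < n" for i j
      using that old[of i j] new[of i j] new[of j i] sym[of i j] by (cases "i < m"; cases "j < m") auto
    show "successively (\<lambda>p q. bil n B (tilt p) (tilt q) = 0) ((z, w) # ps)"
      using ortho by (simp only: successively_map)
  qed (use sym range ij in auto)
qed

text \<open>
  Doubling the first vector of the chain turns it into a chain with an initial vector.
\<close>
lemma chain_determines_of_covers:
  assumes "p \<in> {..<n} \<times> {..<n}" "set ps \<subseteq> {..<n} \<times> {..<n}"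
    and "\<And>j. j < n \<Longrightarrow> (j, j) \<in> set (p # ps)"
    and "\<And>i j. j < n \<Longrightarrow> i < n \<Longrightarrow> i \<noteq> j \<Longrightarrow> covers (fst p) (p # ps) i j"
  shows "chain_determines n (map tilt (p # ps))"
  unfolding chain_determines_def
proof (intro allI impI)
  fix B :: "nat \<Rightarrow> nat \<Rightarrow> real" and i j
  assume *: "\<forall>i j. B i j = B j i" "\<forall>u\<in>set (map tilt (p # ps)). bil n B u u = 0"
    "successively (\<lambda>u v. bil n B u v = 0) (map tilt (p # ps))" "i < n" "j < n"
  show "B i j = 0"
  proof (rule bil_zero_of_covers[where m = 0 and n = n and z = "fst p" and w = "snd p" and ps = "p # ps"])
    show "successively (\<lambda>u v. bil n B u v = 0) (map tilt ((fst p, snd p) # p # ps))"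
      using * by auto
  qed (use assms * in auto)
qed

lemma set_walk_subset:
  "\<rho> \<in> {2, 3, 4, 5} \<Longrightarrow> 4 * g + \<rho> \<le> r \<Longrightarrow> set (walk r \<rho> g) \<subseteq> {..<r + 4} \<times> {..<r + 4}"
proof (induction g)
  case 0
  then show ?case
    using opening_walk_properties[of \<rho>] by (auto simp del: insert_iff)
next
  case (Suc g)
  then show ?case by (auto simp: block_def)
qed

lemma length_walk: "\<rho> \<in> {2, 3, 4, 5} \<Longrightarrow> length (walk r \<rho> g) = 5 + 2 * \<rho> + 8 * g"
  using opening_walk_properties[of \<rho>] by (induction g) (auto simp: block_def)

lemma fst_last_walk:
  assumes "\<rho> \<in> {2, 3, 4, 5}" "\<rho> \<le> r"
  shows "fst (last (walk r \<rho> g)) = r + 3 \<and> walk r \<rho> g \<noteq> []"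
proof (induction g)
  case 0
  have "opening_walk \<rho> \<noteq> []" "fst (last (opening_walk \<rho>)) = \<rho> + 3"
    using opening_walk_properties assms by blast+
  then show ?case
    using assms(2) by (simp add: last_map case_prod_unfold)
qed (simp add: block_def)

lemma trail_map: "trail (map f xs) = (\<lambda>(a, b). (f a, f b)) ` trail xs"
  by (induction xs rule: trail.induct) auto

lemma covers_map:
  assumes "covers z ps i j"
  shows "covers (z + c) (map (\<lambda>(a, b). (a + c, b + c)) ps) (i + c) (j + c)"
proof -
  have "(z + c) # map fst (map (\<lambda>(a, b). (a + c, b + c)) ps) = map (\<lambda>a. a + c) (z # map fst ps)"
    by auto
  then have *: "trail ((z + c) # map fst (map (\<lambda>(a, b). (a + c, b + c)) ps))
      = (\<lambda>(a, b). (a + c, b + c)) ` trail (z # map fst ps)"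
    by (simp only: trail_map)
  have "(a + c, b + c) \<in> (\<lambda>(a, b). (a + c, b + c)) ` S" if "(a, b) \<in> S" for a b S
    using that by force
  then show ?thesis
    using assms unfolding covers_def * set_map Un_iff by blast
qed

lemma covers_append_left: "covers z ps i j \<Longrightarrow> covers z (ps @ qs) i j"
  unfolding covers_def using trail_append_subset[of "z # map fst ps" "map fst qs"] by auto

lemma covers_append_right:
  assumes "ps \<noteq> []" "fst (last ps) = y" "covers y qs i j"
  shows "covers z (ps @ qs) i j"
proof -
  have "z # map fst (ps @ qs) = (z # map fst (butlast ps)) @ y # map fst qs"
    using assms(1,2) by (cases ps rule: rev_cases) auto
  then have "trail (y # map fst qs) \<subseteq> trail (z # map fst (ps @ qs))"
    using trail_append_subset[of "z # map fst (butlast ps)" "y # map fst qs"] by simp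
  then show ?thesis
    using assms(3) unfolding covers_def by auto
qed

lemma block_covers:
  assumes "v \<le> i" "i < v + 4" "r \<le> j" "j < r + 4"
  shows "covers (r + 3) (block r v) i j"
proof -
  have "i = v \<or> i = v + 1 \<or> i = v + 2 \<or> i = v + 3" "j = r \<or> j = r + 1 \<or> j = r + 2 \<or> j = r + 3"
    using assms by auto
  then show ?thesis
    unfolding covers_def block_def by (elim disjE) simp_all
qed

lemma walk_covers:
  assumes rho: "\<rho> \<in> {2, 3, 4, 5}" "4 * g + \<rho> \<le> r"
    and j: "r \<le> j" "j < r + 4"
    and i: "i < 4 * g \<or> r - \<rho> \<le> i" "i < r + 4" "i \<noteq> j"
  shows "covers (r - 1) (walk r \<rho> g) i j"
  using rho(2) i
proof (induction g)
  case 0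
  define c where "c = r - \<rho>"
  have le: "\<rho> \<le> r" using 0 by simp
  have "covers (\<rho> - 1) (opening_walk \<rho>) (i - c) (j - c)"
    using opening_walk_covers(2)[of \<rho> "j - c"] rho(1) 0 j by (auto simp: c_def)
  from covers_map[OF this, of c] show ?case
    using 0 j rho le by (auto simp: c_def)
next
  case (Suc g)
  show ?case
  proof (cases "i < 4 * g \<or> r - \<rho> \<le> i")
    case True
    then show ?thesis
      using Suc covers_append_left[of "r - 1" "walk r \<rho> g"] by simp
  next
    case False
    then have "covers (r + 3) (block r (4 * g)) i j"
      using Suc.prems j by (intro block_covers) auto
    then show ?thesis
      using covers_append_right[of "walk r \<rho> g" "r + 3"] fst_last_walk[of \<rho> r g] rho Suc.prems
      by simp
  qed
qed

lemma walk_loop: 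
  assumes "\<rho> \<in> {2, 3, 4, 5}" "4 * g + \<rho> \<le> r" "r \<le> j" "j < r + 4"
  shows "(j, j) \<in> set (walk r \<rho> g)"
  using assms(2)
proof (induction g)
  case 0
  define c where "c = r - \<rho>"
  have "(j - c, j - c) \<in> set (opening_walk \<rho>)"
    using opening_walk_covers(1)[of \<rho> "j - c"] assms 0 by (auto simp: c_def)
  then show ?case
    using 0 assms by (force simp: c_def)
qed auto

lemma bil_support:
  assumes "\<And>i. i \<ge> r \<Longrightarrow> u i = 0" "\<And>i. i \<ge> r \<Longrightarrow> v i = 0" "r \<le> n"
  shows "bil n B u v = bil r B u v"
proof -
  have *: "(\<Sum>j<n. B i j * u i * v j) = (\<Sum>j<r. B i j * u i * v j)" for i
    by (rule sum.mono_neutral_right) (use assms in auto)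
  show ?thesis
    unfolding bil_def * by (rule sum.mono_neutral_right) (use assms in auto)
qed

text \<open>
  On the first \<open>r\<close> coordinates the chain \<open>us\<close> forces the matrix to vanish. The walk continues at the last
  vertex of that chain and covers the new pairs.
\<close>
lemma chain_determines_extend:
  assumes det: "chain_determines r us" and us: "us \<noteq> []" "\<And>u i. u \<in> set us \<Longrightarrow> r \<le> i \<Longrightarrow> u i = 0"
    and last: "last us = tilt (r - 1, w)" "w < r"
    and r: "r = 4 * g + \<rho>" "\<rho> \<in> {2, 3, 4, 5}"
  shows "chain_determines (r + 4) (us @ map tilt (walk r \<rho> g))"
  unfolding chain_determines_def
proof (intro allI impI)
  let ?n = "r + 4" and ?ps = "walk r \<rho> g"
  fix B :: "nat \<Rightarrow> nat \<Rightarrow> real" and i j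
  assume sym: "\<forall>i j. B i j = B j i" and square: "\<forall>u\<in>set (us @ map tilt ?ps). bil ?n B u u = 0"
    and ortho: "successively (\<lambda>u v. bil ?n B u v = 0) (us @ map tilt ?ps)" and ij: "i < ?n" "j < ?n"
  have eq: "bil ?n B u v = bil r B u v" if "u \<in> set us" "v \<in> set us" for u v
    by (rule bil_support) (use us that in auto)
  have "successively (\<lambda>u v. bil r B u v = 0) us"
    using ortho unfolding successively_append_iff
    by (auto intro: successively_mono[of "\<lambda>u v. bil ?n B u v = 0"] simp: eq)
  moreover have "\<forall>u\<in>set us. bil r B u u = 0"
    using square by (auto simp: eq[symmetric])
  ultimately have old: "B i j = 0" if "i < r" "j < r" for i j
    using det sym that unfolding chain_determines_def by blast
  have ne: "?ps \<noteq> []"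
    using fst_last_walk[of \<rho> r g] r by auto
  show "B i j = 0"
  proof (rule bil_zero_of_covers[where m = r and n = ?n and z = "r - 1" and w = w and ps = ?ps])
    have "hd (map tilt ?ps) = tilt (hd ?ps)"
      using ne by (simp add: hd_map)
    then show "successively (\<lambda>u v. bil ?n B u v = 0) (map tilt ((r - 1, w) # ?ps))"
      using ortho ne us(1) last(1) unfolding successively_append_iff
      by (cases ?ps) auto
    show "covers (r - 1) ?ps i j" if "r \<le> j" "j < ?n" "i < ?n" "i \<noteq> j" for i j
      by (rule walk_covers) (use r that in auto)
    show "(j, j) \<in> set ?ps" if "r \<le> j" "j < ?n" for j
      by (rule walk_loop) (use r that in auto)
    show "set ?ps \<subseteq> {..<?n} \<times> {..<?n}"
      by (rule set_walk_subset) (use r in auto)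
  qed (use sym square ij old last r in auto)
qed

text \<open>
  For \<open>r = 5\<close> the count \<open>15 = 2 * 7 + 1\<close> leaves no freedom, and there is no chain of eight tilted
  vectors that covers all pairs. The conditions for the chain given here can be solved one after the other.
\<close>
lemma chain_determines_five:
  "chain_determines 5 [(\<lambda>i. of_bool (i = 1)), (\<lambda>i. of_bool (i = 2)), (\<lambda>i. of_bool (i = 1) + of_bool (i = 4)),
     (\<lambda>i. of_bool (i = 0) + of_bool (i = 1)), (\<lambda>i. of_bool (i = 2) + of_bool (i = 3)),
     (\<lambda>i. of_bool (i = 0)), (\<lambda>i. of_bool (i = 3)), tilt (4, 4)]"
  (is "chain_determines 5 ?us")
  unfolding chain_determines_def
proof (intro allI impI)
  fix B :: "nat \<Rightarrow> nat \<Rightarrow> real" and i j :: nat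
  assume sym: "\<forall>i j. B i j = B j i" and square: "\<forall>u\<in>set ?us. bil 5 B u u = 0"
    and ortho: "successively (\<lambda>u v. bil 5 B u v = 0) ?us" and ij: "i < 5" "j < 5"
  have five: "{..<5::nat} = {0, 1, 2, 3, 4}"
    by auto
  have eqs: "B 1 0 = B 0 1" "B 2 0 = B 0 2" "B 3 0 = B 0 3" "B 4 0 = B 0 4" "B 2 1 = B 1 2"
    "B 3 1 = B 1 3" "B 4 1 = B 1 4" "B 3 2 = B 2 3" "B 4 2 = B 2 4" "B 4 3 = B 3 4"
    using sym by auto
  have sq: "B 0 0 = 0" "B 1 1 = 0" "B 2 2 = 0" "B 3 3 = 0" "B 4 4 = 0" "B 1 1 + 2 * B 1 4 + B 4 4 = 0"
     "B 0 0 + 2 * B 0 1 + B 1 1 = 0" "B 2 2 + 2 * B 2 3 + B 3 3 = 0"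
    using square unfolding bil_def by (simp_all add: five tilt_def eqs del: One_nat_def)
  moreover have "B 1 2 = 0" "B 1 2 + B 2 4 = 0" "B 0 1 + B 1 1 + B 0 4 + B 1 4 = 0"
     "B 0 2 + B 0 3 + B 1 2 + B 1 3 = 0" "B 0 2 + B 0 3 = 0" "B 0 3 = 0" "B 3 4 = 0"
    using ortho unfolding bil_def by (simp_all add: five tilt_def eqs del: One_nat_def)
  moreover have "i \<in> {0, 1, 2, 3, 4}" "j \<in> {0, 1, 2, 3, 4}"
    using ij by auto
  ultimately show "B i j = 0"
    by (auto simp: eqs simp del: One_nat_def)
qed

lemma less_cases: "(i::nat) < 2 \<longleftrightarrow> i = 0 \<or> i = 1" "i < 3 \<longleftrightarrow> i = 0 \<or> i = 1 \<or> i = 2"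
  "i < 4 \<longleftrightarrow> i = 0 \<or> i = 1 \<or> i = 2 \<or> i = 3"
  by auto

lemma choose_two_add: "(n + 4 + 1) choose 2 = (n + 1 choose 2) + 4 * n + 10"
proof -
  have step: "Suc m choose 2 = (m choose 2) + m" for m
    by (simp add: numeral_2_eq_2)
  have "n + 4 + 1 = Suc (Suc (Suc (Suc (n + 1))))"
    by simp
  then show ?thesis
    by (simp only: step)
qed

text \<open>
  The length is optimal, since a chain of length \<open>L\<close> imposes \<open>2 L - 1\<close> conditions on the
  \<open>r + 1 choose 2\<close> independent entries of a symmetric matrix. Passing from \<open>r\<close> to \<open>r + 4\<close> adds
  \<open>4 r + 10\<close> entries and \<open>2 r + 5\<close> vectors, so the bound is inherited. The last vector is recorded because the next walk starts there.
\<close>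
lemma exists_determining_chain:
  assumes "r \<ge> 2"
  shows "\<exists>us. chain_determines r us \<and> us \<noteq> [] \<and> 2 * length us \<le> (r + 1 choose 2) + 2 \<and>
    (\<forall>u\<in>set us. \<forall>i\<ge>r. u i = 0) \<and> (\<exists>w<r. last us = tilt (r - 1, w))" (is "?P r")
proof -
  define g where "g = (r - 2) div 4"
  \<comment> \<open>the remainder of \<open>r\<close> modulo \<open>4\<close>, taken in the range of the tables\<close>
  define \<rho> where "\<rho> = (r - 2) mod 4 + 2"
  have \<rho>: "\<rho> \<in> {2, 3, 4, 5}" and r: "r = 4 * g + \<rho>"
    using assms by (auto simp: g_def \<rho>_def)
  have "?P (4 * g + \<rho>)"
  proof (induction g)
    case 0
    have 2: "?P 2"
    proof (intro exI conjI)
      show "chain_determines 2 (map tilt [(0, 0), (1, 1)])"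
        by (rule chain_determines_of_covers) (auto simp: covers_def less_cases simp del: One_nat_def)
      show "last (map tilt [(0, 0), (1, 1)]) = tilt (2 - 1, 1)"
        by simp
    qed (auto simp: tilt_def choose_two)
    have 3: "?P 3"
    proof (intro exI conjI)
      show "chain_determines 3 (map tilt [(2, 2), (0, 0), (1, 1), (2, 2)])"
        by (rule chain_determines_of_covers) (auto simp: covers_def less_cases simp del: One_nat_def)
      show "last (map tilt [(2, 2), (0, 0), (1, 1), (2, 2)]) = tilt (3 - 1, 2)"
        by simp
    qed (auto simp: tilt_def choose_two)
    have 4: "?P 4"
    proof (intro exI conjI)
      show "chain_determines 4 (map tilt [(0, 0), (3, 3), (2, 2), (1, 1), (0, 2), (3, 1)])"
        by (rule chain_determines_of_covers) (auto simp: covers_def less_cases simp del: One_nat_def)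
      show "last (map tilt [(0, 0), (3, 3), (2, 2), (1, 1), (0, 2), (3, 1)]) = tilt (4 - 1, 1)"
        by simp
    qed (auto simp: tilt_def choose_two)
    have 5: "?P 5"
    proof (intro exI conjI)
      show "last [(\<lambda>i. of_bool (i = 1)), (\<lambda>i. of_bool (i = 2)), (\<lambda>i. of_bool (i = 1) + of_bool (i = 4)),
          (\<lambda>i. of_bool (i = 0) + of_bool (i = 1)), (\<lambda>i. of_bool (i = 2) + of_bool (i = 3)),
          (\<lambda>i. of_bool (i = 0)), (\<lambda>i. of_bool (i = 3)), tilt (4, 4)] = tilt (5 - 1, 4)"
        by simp
    qed (rule chain_determines_five, auto simp: tilt_def choose_two)
    show ?case
      using \<rho> 2 3 4 5 by (elim insertE emptyE) (simp_all only: mult_0_right add_0)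
  next
    case (Suc g)
    let ?r = "4 * g + \<rho>" and ?ps = "walk (4 * g + \<rho>) \<rho> g"
    obtain us w where us: "chain_determines ?r us" "us \<noteq> []" "2 * length us \<le> (?r + 1 choose 2) + 2"
      "\<forall>u\<in>set us. \<forall>i\<ge>?r. u i = 0" "w < ?r" "last us = tilt (?r - 1, w)"
      using Suc.IH by blast
    have last: "fst (last ?ps) = ?r + 3" "?ps \<noteq> []"
      using fst_last_walk[OF \<rho>, of ?r g] by auto
    have range: "set ?ps \<subseteq> {..<?r + 4} \<times> {..<?r + 4}"
      by (rule set_walk_subset[OF \<rho>]) simp
    have len: "2 * length (us @ map tilt ?ps) \<le> (?r + 4 + 1 choose 2) + 2"
      using us(3) length_walk[OF \<rho>, of ?r g] unfolding choose_two_add by simp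
    have "?P (?r + 4)"
    proof (intro exI conjI)
      show "chain_determines (?r + 4) (us @ map tilt ?ps)"
        by (rule chain_determines_extend) (use us \<rho> in auto)
      show "\<forall>u\<in>set (us @ map tilt ?ps). \<forall>i\<ge>?r + 4. u i = 0"
        using us(4) range by (fastforce simp: tilt_def)
      show "snd (last ?ps) < ?r + 4"
        using range last_in_set[OF last(2)] by auto
      show "last (us @ map tilt ?ps) = tilt (?r + 4 - 1, snd (last ?ps))"
        using last surjective_pairing[of "last ?ps"] us(2) by (simp add: last_map add.commute[of _ 3])
    qed (use len us in auto)
    then show ?case
      by (simp add: add.commute add.left_commute)
  qed
  then show ?thesis
    using r by simp
qed

section \<open>Existence of quadratically independent forms\<close>

text \<open>
  The least value of \<open>k\<^sup>2 + l\<^sup>2\<close> for \<open>k + l = m\<close>. By strict convexity it is attained only if \<open>k\<close> and \<open>l\<close>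
  differ by at most one, which is why consecutive vectors of a chain are the ones that matter.
\<close>
definition min_square_sum :: "nat \<Rightarrow> nat" where
  "min_square_sum m = (m\<^sup>2 + 1) div 2"

lemma min_square_sum_le: "min_square_sum (k + l) \<le> k\<^sup>2 + l\<^sup>2"
proof -
  have "(k + l)\<^sup>2 \<le> 2 * (k\<^sup>2 + l\<^sup>2)"
  proof -
    have "0 \<le> (int k - int l)\<^sup>2"
      by simp
    then have "int ((k + l)\<^sup>2) \<le> int (2 * (k\<^sup>2 + l\<^sup>2))"
      by (simp add: power2_eq_square algebra_simps)
    then show ?thesis
      by linarith
  qed
  then show ?thesis
    unfolding min_square_sum_def by simp
qed

lemma min_square_sum_eq_iff: "k\<^sup>2 + l\<^sup>2 = min_square_sum (k + l) \<longleftrightarrow> k = l \<or> k = Suc l \<or> l = Suc k"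
proof -
  have *: "(k + (k + n))\<^sup>2 + n\<^sup>2 = 2 * (k\<^sup>2 + (k + n)\<^sup>2)" for k n :: nat
    by (simp add: power2_eq_square algebra_simps)
  have main: "k\<^sup>2 + (k + n)\<^sup>2 = min_square_sum (k + (k + n)) \<longleftrightarrow> n = 0 \<or> n = 1" for k n
  proof (cases "n \<le> 1")
    case True
    then consider "n = 0" | "n = 1" by linarith
    then show ?thesis
      using *[of k n] by cases (simp_all add: min_square_sum_def)
  next
    case False
    then have "n\<^sup>2 \<ge> 2\<^sup>2"
      by (intro power_mono) auto
    then show ?thesis
      using *[of k n] False unfolding min_square_sum_def by simp
  qed
  show ?thesis
  proof (cases "k \<le> l")
    case True
    then show ?thesis
      using main[of k "l - k"] by auto
  next
    case False
    then show ?thesis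
      using main[of l "k - l"] by (auto simp: add.commute)
  qed
qed

definition chain_form :: "nat \<Rightarrow> (nat \<Rightarrow> real) list \<Rightarrow> real \<Rightarrow> nat \<Rightarrow> bipoly" where
  "chain_form d us t i = (\<Sum>k<length us. (t ^ k\<^sup>2 * (us ! k) i) *\<^sub>R mon d k)"

text \<open>
  The product of two chain forms, with its coefficient at each \<open>m\<close> divided by the lowest power of \<open>t\<close>
  that can occur in it. Thus \<open>t = 0\<close> makes sense and gives the products for the degenerate curve.
\<close>
definition chain_product :: "nat \<Rightarrow> (nat \<Rightarrow> real) list \<Rightarrow> nat \<Rightarrow> nat \<Rightarrow> real \<Rightarrow> bipoly" where
  "chain_product d us i j t = (\<Sum>k<length us. \<Sum>l<length us.
     (t ^ (k\<^sup>2 + l\<^sup>2 - min_square_sum (k + l)) * ((us ! k) i * (us ! l) j)) *\<^sub>R mon (2 * d) (k + l))"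

definition rescale :: "nat \<Rightarrow> real \<Rightarrow> bipoly \<Rightarrow> bipoly" where
  "rescale n t y = (\<Sum>m\<le>n. (coef y (m, n - m) / t ^ min_square_sum m) *\<^sub>R mon n m)"

lemma linear_rescale: "linear (rescale n t)"
  unfolding rescale_def
  by (rule linearI) (simp_all add: lookup_add lookup_scaleR_pm add_divide_distrib scaleR_add_left sum.distrib scaleR_sum_right)

lemma rescale_mon: "m \<le> n \<Longrightarrow> rescale n t (mon n m) = (1 / t ^ min_square_sum m) *\<^sub>R mon n m"
  by (simp add: rescale_def coef_mon of_bool_def if_distrib[of "\<lambda>x. x / _"] if_distrib[of "\<lambda>x. x *\<^sub>R _"] cong: if_cong)

lemma chain_form_in_forms: "length us \<le> d + 1 \<Longrightarrow> chain_form d us t i \<in> forms d"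
  unfolding chain_form_def
  by (intro subspace_sum[OF subspace_forms] subspace_scale[OF subspace_forms] mon_in_forms) simp

lemma rescale_chain_form_mult:
  assumes "length us \<le> d + 1" "t \<noteq> 0"
  shows "rescale (2 * d) t (chain_form d us t i * chain_form d us t j) = chain_product d us i j t"
proof -
  have "chain_form d us t i * chain_form d us t j = (\<Sum>k<length us. \<Sum>l<length us.
     (t ^ (k\<^sup>2 + l\<^sup>2) * ((us ! k) i * (us ! l) j)) *\<^sub>R mon (2 * d) (k + l))"
    unfolding chain_form_def sum_product
  proof (intro sum.cong refl)
    fix k l assume "k \<in> {..<length us}" "l \<in> {..<length us}"
    then have "k \<le> d" "l \<le> d"
      using assms(1) by auto
    then show "(t ^ k\<^sup>2 * (us ! k) i) *\<^sub>R mon d k * (t ^ l\<^sup>2 * (us ! l) j) *\<^sub>R mon d l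
        = (t ^ (k\<^sup>2 + l\<^sup>2) * ((us ! k) i * (us ! l) j)) *\<^sub>R mon (2 * d) (k + l)"
      unfolding scaleR_mult_scaleR_bipoly by (simp add: mon_mult power_add mult_ac flip: mult_2)
  qed
  then have "rescale (2 * d) t (chain_form d us t i * chain_form d us t j) = (\<Sum>k<length us. \<Sum>l<length us.
     (t ^ (k\<^sup>2 + l\<^sup>2) * ((us ! k) i * (us ! l) j)) *\<^sub>R rescale (2 * d) t (mon (2 * d) (k + l)))"
    by (simp only: linear_sum[OF linear_rescale] linear_cmul[OF linear_rescale])
  also have "\<dots> = chain_product d us i j t"
    unfolding chain_product_def
  proof (intro sum.cong refl)
    fix k l assume "k \<in> {..<length us}" "l \<in> {..<length us}"
    then have "k + l \<le> 2 * d"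
      using assms(1) by auto
    moreover have "t ^ (k\<^sup>2 + l\<^sup>2) / t ^ min_square_sum (k + l) = t ^ (k\<^sup>2 + l\<^sup>2 - min_square_sum (k + l))"
      using assms(2) min_square_sum_le[of k l] by (simp add: power_diff)
    ultimately show "(t ^ (k\<^sup>2 + l\<^sup>2) * ((us ! k) i * (us ! l) j)) *\<^sub>R rescale (2 * d) t (mon (2 * d) (k + l))
        = (t ^ (k\<^sup>2 + l\<^sup>2 - min_square_sum (k + l)) * ((us ! k) i * (us ! l) j)) *\<^sub>R mon (2 * d) (k + l)"
      by (simp add: rescale_mon flip: \<open>t ^ (k\<^sup>2 + l\<^sup>2) / t ^ min_square_sum (k + l) = t ^ (k\<^sup>2 + l\<^sup>2 - min_square_sum (k + l))\<close>)
  qed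
  finally show ?thesis .
qed

lemma chain_product_sym: "chain_product d us i j t = chain_product d us j i t"
  unfolding chain_product_def by (subst sum.swap) (simp add: add.commute mult.commute)

lemma coef_sum_chain_product:
  assumes m: "m \<le> 2 * d"
  shows "coef (\<Sum>i<r. \<Sum>j<r. A i j *\<^sub>R chain_product d us i j 0) (m, 2 * d - m)
    = (\<Sum>k<length us. \<Sum>l<length us. of_bool (k + l = m \<and> (k = l \<or> k = Suc l \<or> l = Suc k)) * bil r A (us ! k) (us ! l))"
proof -
  let ?L = "length us"
  let ?\<epsilon> = "\<lambda>k l. of_bool (k + l = m \<and> (k = l \<or> k = Suc l \<or> l = Suc k)) :: real"
  have pow: "(0 :: real) ^ (k\<^sup>2 + l\<^sup>2 - min_square_sum (k + l)) = of_bool (k = l \<or> k = Suc l \<or> l = Suc k)" for k l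
    using min_square_sum_le[of k l] min_square_sum_eq_iff[of k l] by (auto simp: power_0_left)
  have "coef (chain_product d us i j 0) (m, 2 * d - m) = (\<Sum>k<?L. \<Sum>l<?L. ?\<epsilon> k l * ((us ! k) i * (us ! l) j))" for i j
    unfolding chain_product_def pow lookup_sum lookup_scaleR_pm coef_mon by (intro sum.cong refl) auto
  then have "coef (\<Sum>i<r. \<Sum>j<r. A i j *\<^sub>R chain_product d us i j 0) (m, 2 * d - m)
      = (\<Sum>i<r. \<Sum>j<r. \<Sum>k<?L. \<Sum>l<?L. ?\<epsilon> k l * (A i j * (us ! k) i * (us ! l) j))"
    by (simp add: lookup_sum lookup_scaleR_pm sum_distrib_left mult_ac)
  also have "\<dots> = (\<Sum>i<r. \<Sum>k<?L. \<Sum>j<r. \<Sum>l<?L. ?\<epsilon> k l * (A i j * (us ! k) i * (us ! l) j))"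
    by (rule sum.cong[OF refl], rule sum.swap)
  also have "\<dots> = (\<Sum>k<?L. \<Sum>i<r. \<Sum>j<r. \<Sum>l<?L. ?\<epsilon> k l * (A i j * (us ! k) i * (us ! l) j))"
    by (rule sum.swap)
  also have "\<dots> = (\<Sum>k<?L. \<Sum>i<r. \<Sum>l<?L. \<Sum>j<r. ?\<epsilon> k l * (A i j * (us ! k) i * (us ! l) j))"
    by (rule sum.cong[OF refl], rule sum.cong[OF refl], rule sum.swap)
  also have "\<dots> = (\<Sum>k<?L. \<Sum>l<?L. \<Sum>i<r. \<Sum>j<r. ?\<epsilon> k l * (A i j * (us ! k) i * (us ! l) j))"
    by (rule sum.cong[OF refl], rule sum.swap)
  finally show ?thesis
    by (simp only: bil_def sum_distrib_left)
qed

lemma sum_pick: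
  fixes h :: "nat \<Rightarrow> nat \<Rightarrow> real"
  assumes "a < L" "b < L"
  shows "(\<Sum>k<L. \<Sum>l<L. of_bool (k = a \<and> l = b) * h k l) = h a b"
proof -
  have "(\<Sum>k<L. \<Sum>l<L. of_bool (k = a \<and> l = b) * h k l) = (\<Sum>k<L. if k = a then h a b else 0)"
    using assms by (intro sum.cong refl) (auto simp: of_bool_def if_distrib[of "\<lambda>x. x * _"] cong: if_cong)
  then show ?thesis
    using assms by simp
qed

lemma bil_sym: "(\<And>i j. A i j = A j i) \<Longrightarrow> bil r A u v = bil r A v u"
  unfolding bil_def by (subst sum.swap) (simp add: mult_ac)

text \<open>
  At \<open>t = 0\<close> the even coefficients are \<open>A(u\<^sub>k, u\<^sub>k)\<close> and the odd ones \<open>2 A(u\<^sub>k, u\<^sub>k\<^sub>+\<^sub>1)\<close>, which are the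
  conditions of a determining chain.
\<close>
lemma sym_indep_chain_product:
  assumes det: "chain_determines r us" and len: "length us \<le> d + 1"
  shows "sym_indep r (\<lambda>i j. chain_product d us i j 0)"
  unfolding sym_indep_def
proof (intro allI impI)
  fix A :: "nat \<Rightarrow> nat \<Rightarrow> real" and i j
  assume sym: "\<forall>i j. A i j = A j i" and zero: "(\<Sum>i<r. \<Sum>j<r. A i j *\<^sub>R chain_product d us i j 0) = 0"
    and ij: "i < r" "j < r"
  let ?L = "length us"
  have coeff: "(\<Sum>k<?L. \<Sum>l<?L. of_bool (k + l = m \<and> (k = l \<or> k = Suc l \<or> l = Suc k)) * bil r A (us ! k) (us ! l)) = 0"
    if "m \<le> 2 * d" for m
    using coef_sum_chain_product[OF that, of A us r] zero by simp
  have "bil r A (us ! a) (us ! a) = 0" if a: "a < ?L" for a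
  proof -
    have "(k + l = 2 * a \<and> (k = l \<or> k = Suc l \<or> l = Suc k)) \<longleftrightarrow> k = a \<and> l = a" for k l
      by presburger
    then show ?thesis
      using coeff[of "2 * a"] a len sum_pick[OF a a, of "\<lambda>k l. bil r A (us ! k) (us ! l)"] by simp
  qed
  then have square: "\<forall>u\<in>set us. bil r A u u = 0"
    by (metis in_set_conv_nth)
  have "bil r A (us ! a) (us ! Suc a) = 0" if a: "Suc a < ?L" for a
  proof -
    have "(k + l = 2 * a + 1 \<and> (k = l \<or> k = Suc l \<or> l = Suc k)) \<longleftrightarrow> (k = a \<and> l = Suc a) \<or> (k = Suc a \<and> l = a)" for k l
      by presburger
    then have *: "of_bool (k + l = 2 * a + 1 \<and> (k = l \<or> k = Suc l \<or> l = Suc k))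
        = (of_bool (k = a \<and> l = Suc a) + of_bool (k = Suc a \<and> l = a) :: real)" for k l
      by auto
    have "bil r A (us ! a) (us ! Suc a) + bil r A (us ! Suc a) (us ! a) = 0"
      using coeff[of "2 * a + 1"] a len sum_pick[of a ?L "Suc a" "\<lambda>k l. bil r A (us ! k) (us ! l)"]
        sum_pick[of "Suc a" ?L a "\<lambda>k l. bil r A (us ! k) (us ! l)"]
      unfolding * by (simp add: distrib_right sum.distrib)
    then show ?thesis
      using bil_sym[of A r "us ! a" "us ! Suc a"] sym by simp
  qed
  then have "successively (\<lambda>u v. bil r A u v = 0) us"
    by (simp add: successively_conv_nth)
  then show "A i j = 0"
    using det sym square ij unfolding chain_determines_def by blast
qed

text \<open>
  Independence at \<open>t = 0\<close> spreads to all but finitely many \<open>t\<close>. For \<open>t \<noteq> 0\<close> the rescaling of coefficients can be undone.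
\<close>
theorem exists_qindep:
  assumes r: "r \<ge> 2" "(r + 1) choose 2 \<le> 2 * d + 1"
  shows "\<exists>p. (\<forall>i. p i \<in> forms d) \<and> qindep r p"
proof -
  obtain us where us: "chain_determines r us" "2 * length us \<le> (r + 1 choose 2) + 2"
    using exists_determining_chain[OF r(1)] by blast
  then have len: "length us \<le> d + 1"
    using r(2) by linarith
  let ?w = "\<lambda>t (i, j). chain_product d us i j t"
  have "finite {t. \<not> indep_family (upper r) (?w t)}"
  proof (rule finite_dependent_poly_curve)
    show "poly_curve (\<lambda>t. ?w t k)" for k
      unfolding chain_product_def scaleR_scaleR[symmetric] case_prod_beta'
      by (intro poly_curve_sum poly_curve_power)
    show "indep_family (upper r) (?w 0)"
      using sym_indep_chain_product[OF us(1) len] sym_indep_iff[of "\<lambda>i j. chain_product d us i j 0" r]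
      by (simp add: chain_product_sym)
  qed (rule finite_upper)
  then have "finite (insert 0 {t. \<not> indep_family (upper r) (?w t)})"
    by simp
  then obtain t where t: "t \<noteq> 0" "indep_family (upper r) (?w t)"
    using ex_new_if_finite[OF infinite_UNIV_char_0] by blast
  let ?p = "chain_form d us t"
  have "indep_family (upper r) (\<lambda>k. rescale (2 * d) t (case k of (i, j) \<Rightarrow> ?p i * ?p j))"
    using t(2) rescale_chain_form_mult[OF len t(1)] by (simp add: case_prod_beta')
  then have "indep_family (upper r) (\<lambda>(i, j). ?p i * ?p j)"
    by (rule indep_family_linear_image[OF linear_rescale])
  then show ?thesis
    using chain_form_in_forms[OF len] qindep_iff by blast
qed

section \<open>Local surjectivity of sums of squares\<close>

text \<open>
  This says that the derivative of \<open>(p, q) \<mapsto> p\<^sup>2 + q\<^sup>2\<close> is onto. It amounts to \<open>p\<close> and \<open>q\<close> having no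
  common factor.
\<close>
definition generates :: "nat \<Rightarrow> bipoly \<Rightarrow> bipoly \<Rightarrow> bool" where
  "generates d p q \<longleftrightarrow> (\<forall>y\<in>forms (2 * d). \<exists>a\<in>forms d. \<exists>b\<in>forms d. y = p * a + q * b)"

text \<open>
  The columns of the Sylvester matrix of \<open>p\<close> and \<open>q\<close>, numbered by \<open>{..2 * d}\<close>. Since \<open>p q - q p = 0\<close> is always
  a relation, one of the \<open>2 d + 2\<close> products has to be left out; here it is \<open>q * mon d 0\<close>, so that
  for \<open>p = mon d 0\<close> and \<open>q = mon d d\<close> the columns are the monomials in their order.
\<close>
definition sylvester :: "nat \<Rightarrow> bipoly \<Rightarrow> bipoly \<Rightarrow> nat \<Rightarrow> bipoly" where
  "sylvester d p q k = (if k \<le> d then p * mon d k else q * mon d (k - d))"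

lemma sylvester_in_forms:
  assumes "p \<in> forms d" "q \<in> forms d" "k \<le> 2 * d"
  shows "sylvester d p q k \<in> forms (2 * d)"
  using assms unfolding sylvester_def mult_2 by (auto intro!: forms_mult mon_in_forms)

lemma indep_family_mon: "indep_family {..n} (mon n)"
  unfolding indep_family_def
proof (intro allI impI ballI)
  fix c k assume "(\<Sum>i\<le>n. c i *\<^sub>R mon n i) = 0" "k \<in> {..n}"
  then show "c k = 0"
    using coef_sum_mon[of k n c] by simp
qed

lemma span_mon: "span (mon n ` {..n}) = forms n"
proof (rule span_unique)
  show "mon n ` {..n} \<subseteq> forms n"
    by (auto simp: mon_in_forms)
  show "forms n \<subseteq> V" if "mon n ` {..n} \<subseteq> V" "subspace V" for V
  proof
    fix p assume "p \<in> forms n"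
    then have "p = (\<Sum>k\<le>n. coef p (k, n - k) *\<^sub>R mon n k)"
      by (rule forms_expansion)
    also have "\<dots> \<in> V"
      using that by (intro subspace_sum subspace_scale) auto
    finally show "p \<in> V" .
  qed
qed (rule subspace_forms)

lemma generates_if_sylvester_indep:
  assumes p: "p \<in> forms d" "q \<in> forms d" and ind: "indep_family {..2 * d} (sylvester d p q)"
  shows "generates d p q"
  unfolding generates_def
proof
  fix y assume y: "y \<in> forms (2 * d)"
  let ?B = "sylvester d p q ` {..2 * d}" and ?M = "mon (2 * d) ` {..2 * d}"
  note B = indep_family_independent[OF finite_atMost ind]
  have sub: "?B \<subseteq> span ?M"
    unfolding span_mon using sylvester_in_forms[OF p] by auto
  have "y \<in> span ?B"
  proof (rule ccontr)
    assume n: "y \<notin> span ?B"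
    then have "independent (insert y ?B)"
      using B(2) by (rule independent_insertI)
    moreover have "y \<notin> ?B"
      using n span_base by metis
    ultimately have "card (insert y ?B) \<le> card ?M"
      using sub y independent_span_bound[of ?M "insert y ?B"] by (simp add: span_mon)
    moreover have "card ?M \<le> 2 * d + 1"
      using card_image_le[of "{..2 * d}" "mon (2 * d)"] by simp
    moreover have "card ?B = 2 * d + 1"
      using card_image[OF B(1)] by simp
    ultimately show False
      using n span_base[of y ?B] by (simp add: card_insert_if split: if_splits)
  qed
  then obtain c where "y = (\<Sum>v\<in>?B. c v *\<^sub>R v)"
    by (auto simp: span_finite)
  then have "y = (\<Sum>k\<le>2 * d. c (sylvester d p q k) *\<^sub>R sylvester d p q k)"
    by (simp add: sum.reindex[OF B(1)])
  also have "\<dots> = (\<Sum>k\<in>{..d} \<union> {d<..2 * d}. c (sylvester d p q k) *\<^sub>R sylvester d p q k)"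
    by (rule sum.cong) auto
  also have "\<dots> = (\<Sum>k\<le>d. c (sylvester d p q k) *\<^sub>R sylvester d p q k)
      + (\<Sum>k\<in>{d<..2 * d}. c (sylvester d p q k) *\<^sub>R sylvester d p q k)"
    by (rule sum.union_disjoint) auto
  also have "\<dots> = p * (\<Sum>k\<le>d. c (sylvester d p q k) *\<^sub>R mon d k)
      + q * (\<Sum>k\<in>{d<..2 * d}. c (sylvester d p q k) *\<^sub>R mon d (k - d))"
    by (simp add: sylvester_def sum_distrib_left scaleR_bipoly_mult)
  finally have "y = p * (\<Sum>k\<le>d. c (sylvester d p q k) *\<^sub>R mon d k)
      + q * (\<Sum>k\<in>{d<..2 * d}. c (sylvester d p q k) *\<^sub>R mon d (k - d))" .
  moreover have "(\<Sum>k\<le>d. c (sylvester d p q k) *\<^sub>R mon d k) \<in> forms d"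
    by (intro subspace_sum[OF subspace_forms] subspace_scale[OF subspace_forms] mon_in_forms) simp
  moreover have "(\<Sum>k\<in>{d<..2 * d}. c (sylvester d p q k) *\<^sub>R mon d (k - d)) \<in> forms d"
    by (intro subspace_sum[OF subspace_forms] subspace_scale[OF subspace_forms] mon_in_forms) auto
  ultimately show "\<exists>a\<in>forms d. \<exists>b\<in>forms d. y = p * a + q * b"
    by blast
qed

text \<open>
  Let \<open>y \<mapsto> (a, b)\<close> be a linear right inverse of \<open>(a, b) \<mapsto> 2 (p a + q b)\<close>. The equation for \<open>a\<close> and \<open>b\<close> becomes
  \<open>y = h - (a\<^sup>2 + b\<^sup>2)\<close>, whose right side is a contraction on a small ball because \<open>a\<close> and \<open>b\<close> enter
  quadratically.
\<close>
lemma sum_two_squares_locally_surjective: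
  assumes pq: "p \<in> forms d" "q \<in> forms d" and gen: "generates d p q" and "\<epsilon> > 0"
  obtains \<delta> where "\<delta> > 0" "\<And>h. h \<in> forms (2 * d) \<Longrightarrow> norm h < \<delta> \<Longrightarrow>
    \<exists>a\<in>forms d. \<exists>b\<in>forms d. norm a < \<epsilon> \<and> norm b < \<epsilon> \<and> (p + a)\<^sup>2 + (q + b)\<^sup>2 = p\<^sup>2 + q\<^sup>2 + h"
proof -
  let ?W = "forms (2 * d)"
  have "\<forall>k. \<exists>a b. k \<le> 2 * d \<longrightarrow> a \<in> forms d \<and> b \<in> forms d \<and> mon (2 * d) k = p * a + q * b"
    using gen mon_in_forms[of _ "2 * d"] unfolding generates_def by blast
  then obtain \<alpha> \<beta> where ab: "\<And>k. k \<le> 2 * d \<Longrightarrow> \<alpha> k \<in> forms d \<and> \<beta> k \<in> forms d \<and> mon (2 * d) k = p * \<alpha> k + q * \<beta> k"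
    by metis
  define lin where "lin = (\<lambda>(\<gamma> :: nat \<Rightarrow> bipoly) y. \<Sum>k\<le>2 * d. (coef y (k, 2 * d - k) / 2) *\<^sub>R \<gamma> k)"
  have linear: "linear (lin \<gamma>)" for \<gamma>
    unfolding lin_def
    by (rule linearI) (simp_all add: lookup_add lookup_scaleR_pm add_divide_distrib scaleR_add_left sum.distrib scaleR_sum_right)
  have solve: "2 * (p * lin \<alpha> y + q * lin \<beta> y) = y" if "y \<in> ?W" for y
  proof -
    have "2 * (p * lin \<alpha> y + q * lin \<beta> y)
        = (\<Sum>k\<le>2 * d. 2 * (p * ((coef y (k, 2 * d - k) / 2) *\<^sub>R \<alpha> k) + q * ((coef y (k, 2 * d - k) / 2) *\<^sub>R \<beta> k)))"
      by (simp add: lin_def sum_distrib_left sum.distrib distrib_left)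
    also have "\<dots> = (\<Sum>k\<le>2 * d. coef y (k, 2 * d - k) *\<^sub>R (p * \<alpha> k + q * \<beta> k))"
    proof (rule sum.cong[OF refl])
      fix k
      have "2 * ((c / 2) *\<^sub>R x + (c / 2) *\<^sub>R y) = c *\<^sub>R (x + y)" for c and x y :: bipoly
        by (simp add: mult_2 scaleR_add_right flip: scaleR_add_left)
      then show "2 * (p * ((coef y (k, 2 * d - k) / 2) *\<^sub>R \<alpha> k) + q * ((coef y (k, 2 * d - k) / 2) *\<^sub>R \<beta> k))
          = coef y (k, 2 * d - k) *\<^sub>R (p * \<alpha> k + q * \<beta> k)"
        by (simp add: scaleR_bipoly_mult)
    qed
    also have "\<dots> = (\<Sum>k\<le>2 * d. coef y (k, 2 * d - k) *\<^sub>R mon (2 * d) k)"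
      by (rule sum.cong) (simp_all add: ab)
    finally show ?thesis
      using forms_expansion[OF that] by simp
  qed
  obtain C1 where C1: "C1 > 0" "\<And>y. y \<in> ?W \<Longrightarrow> norm (lin \<alpha> y) \<le> C1 * norm y"
    using linear_bounded_on_forms[OF linear[of \<alpha>], where n = "2 * d"] by blast
  obtain C2 where C2: "C2 > 0" "\<And>y. y \<in> ?W \<Longrightarrow> norm (lin \<beta> y) \<le> C2 * norm y"
    using linear_bounded_on_forms[OF linear[of \<beta>], where n = "2 * d"] by blast
  define C where "C = max C1 C2"
  have C: "norm (lin \<alpha> y) \<le> C * norm y" "norm (lin \<beta> y) \<le> C * norm y" if "y \<in> ?W" for y
    using C1(2)[OF that] C2(2)[OF that] mult_right_mono[of C1 C "norm y"] mult_right_mono[of C2 C "norm y"]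
    by (simp_all add: C_def)
  have C0: "C > 0"
    using C1(1) by (simp add: C_def)
  \<comment> \<open>the radius of the ball: the first bound gives the contraction, the second keeps the
     corrections below \<open>\<epsilon>\<close>\<close>
  define \<rho> where "\<rho> = min (1 / (8 * C\<^sup>2)) (\<epsilon> / (2 * C))"
  have \<rho>: "\<rho> > 0" "C * \<rho> < \<epsilon>" "8 * C\<^sup>2 * \<rho> \<le> 1"
  proof -
    show "\<rho> > 0"
      using C0 \<open>\<epsilon> > 0\<close> by (simp add: \<rho>_def)
    have "C * \<rho> \<le> C * (\<epsilon> / (2 * C))" "8 * C\<^sup>2 * \<rho> \<le> 8 * C\<^sup>2 * (1 / (8 * C\<^sup>2))"
      using C0 by (intro mult_left_mono; simp add: \<rho>_def)+
    then show "C * \<rho> < \<epsilon>" "8 * C\<^sup>2 * \<rho> \<le> 1"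
      using C0 \<open>\<epsilon> > 0\<close> by simp_all
  qed
  let ?S = "?W \<inter> cball 0 \<rho>"
  have square_diff: "norm ((lin \<gamma> y)\<^sup>2 - (lin \<gamma> z)\<^sup>2) \<le> 2 * C\<^sup>2 * \<rho> * norm (y - z)"
    if \<gamma>: "\<And>y. y \<in> ?W \<Longrightarrow> norm (lin \<gamma> y) \<le> C * norm y" and yz: "y \<in> ?S" "z \<in> ?S" for \<gamma> y z
  proof -
    have "(lin \<gamma> y)\<^sup>2 - (lin \<gamma> z)\<^sup>2 = lin \<gamma> (y - z) * (lin \<gamma> y + lin \<gamma> z)"
      by (simp add: linear_diff[OF linear] power2_eq_square algebra_simps)
    then have "norm ((lin \<gamma> y)\<^sup>2 - (lin \<gamma> z)\<^sup>2) \<le> norm (lin \<gamma> (y - z)) * norm (lin \<gamma> y + lin \<gamma> z)"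
      by (simp add: norm_bipoly_mult)
    also have "\<dots> \<le> (C * norm (y - z)) * (2 * (C * \<rho>))"
    proof (intro mult_mono)
      show "norm (lin \<gamma> (y - z)) \<le> C * norm (y - z)"
        using yz by (intro \<gamma> subspace_diff[OF subspace_forms]) auto
      have bound: "norm (lin \<gamma> y) \<le> C * \<rho>" if "y \<in> ?S" for y
        using \<gamma>[of y] that C0 order_trans[OF _ mult_left_mono[of "norm y" \<rho> C]] by auto
      show "norm (lin \<gamma> y + lin \<gamma> z) \<le> 2 * (C * \<rho>)"
        using order_trans[OF norm_triangle_ineq add_mono[OF bound[OF yz(1)] bound[OF yz(2)]]] by simp
    qed (use C0 in auto)
    finally show ?thesis
      by (simp add: power2_eq_square mult_ac)
  qed
  have lin_forms: "lin \<alpha> y \<in> forms d" "lin \<beta> y \<in> forms d" for y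
    unfolding lin_def using ab by (auto intro!: subspace_sum[OF subspace_forms] subspace_scale[OF subspace_forms])
  have zero: "lin \<gamma> 0 = 0" for \<gamma>
    by (rule linear_0[OF linear])
  have "\<exists>a\<in>forms d. \<exists>b\<in>forms d. norm a < \<epsilon> \<and> norm b < \<epsilon> \<and> (p + a)\<^sup>2 + (q + b)\<^sup>2 = p\<^sup>2 + q\<^sup>2 + h"
    if h: "h \<in> ?W" "norm h < \<rho> / 2" for h
  proof -
    define T where "T = (\<lambda>y. h - ((lin \<alpha> y)\<^sup>2 + (lin \<beta> y)\<^sup>2))"
    have contr: "norm (T y - T z) \<le> 1 / 2 * norm (y - z)" if yz: "y \<in> ?S" "z \<in> ?S" for y z
    proof -
      have "T y - T z = - (((lin \<alpha> y)\<^sup>2 - (lin \<alpha> z)\<^sup>2) + ((lin \<beta> y)\<^sup>2 - (lin \<beta> z)\<^sup>2))"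
        by (simp add: T_def)
      then have "norm (T y - T z) \<le> norm ((lin \<alpha> y)\<^sup>2 - (lin \<alpha> z)\<^sup>2) + norm ((lin \<beta> y)\<^sup>2 - (lin \<beta> z)\<^sup>2)"
        by (simp only: norm_minus_cancel norm_triangle_ineq)
      also have "\<dots> \<le> 2 * C\<^sup>2 * \<rho> * norm (y - z) + 2 * C\<^sup>2 * \<rho> * norm (y - z)"
        by (intro add_mono square_diff C yz)
      also have "\<dots> = (8 * C\<^sup>2 * \<rho>) / 2 * norm (y - z)"
        by simp
      also have "\<dots> \<le> 1 / 2 * norm (y - z)"
        by (intro mult_right_mono divide_right_mono \<rho>(3)) auto
      finally show ?thesis .
    qed
    have T0: "T 0 = h"
      by (simp add: T_def zero)
    have "\<exists>!y\<in>?S. T y = y"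
    proof (rule Banach_fix[where c = "1 / 2"])
      show "complete ?S"
        by (intro complete_Int_closed complete_forms closed_cball)
      show "?S \<noteq> {}"
      proof -
        have "0 \<in> ?S"
          using \<rho>(1) subspace_0[OF subspace_forms] by simp
        then show ?thesis
          by blast
      qed
      show "T ` ?S \<subseteq> ?S"
      proof (rule image_subsetI, rule IntI)
        fix y assume y: "y \<in> ?S"
        show "T y \<in> ?W"
          unfolding T_def
          by (intro subspace_diff[OF subspace_forms] subspace_add[OF subspace_forms] forms_square lin_forms h)
        have "norm (T y - T 0) \<le> 1 / 2 * norm (y - 0)"
          by (rule contr) (use y \<rho>(1) subspace_0[OF subspace_forms] in auto)
        then have "norm (T y) \<le> norm h + 1 / 2 * norm y"
          using norm_triangle_ineq[of "T y - T 0" "T 0"] by (simp add: T0)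
        then show "T y \<in> cball 0 \<rho>"
          using h(2) y by (simp add: dist_norm)
      qed
      show "dist (T y) (T z) \<le> 1 / 2 * dist y z" if "y \<in> ?S" "z \<in> ?S" for y z
        using contr[OF that] by (simp add: dist_norm)
    qed auto
    then obtain y where y: "y \<in> ?W" "norm y \<le> \<rho>" "T y = y"
      by (auto simp: dist_norm)
    have small: "norm (lin \<alpha> y) < \<epsilon>" "norm (lin \<beta> y) < \<epsilon>"
      using C[OF y(1)] mult_left_mono[OF y(2), of C] C0 \<rho>(2) by linarith+
    have "(p + lin \<alpha> y)\<^sup>2 + (q + lin \<beta> y)\<^sup>2
        = p\<^sup>2 + q\<^sup>2 + (2 * (p * lin \<alpha> y + q * lin \<beta> y) + ((lin \<alpha> y)\<^sup>2 + (lin \<beta> y)\<^sup>2))"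
      by (simp add: power2_eq_square algebra_simps)
    also have "\<dots> = p\<^sup>2 + q\<^sup>2 + h"
      using y(3) unfolding solve[OF y(1)] T_def by (simp add: algebra_simps)
    finally show ?thesis
      using small lin_forms by blast
  qed
  then show thesis
    using that[of "\<rho> / 2"] \<rho>(1) by simp
qed

text \<open>
  Apply the dual functionals of \<open>v\<close> to a relation between the \<open>w i\<close>: the coefficients are bounded by a
  multiple, less than one, of their own sum.
\<close>
lemma indep_family_stable:
  fixes v :: "'i \<Rightarrow> bipoly"
  assumes I: "finite I" and v: "indep_family I v" "\<And>i. i \<in> I \<Longrightarrow> v i \<in> forms n"
  obtains \<delta> where "\<delta> > 0" "\<And>w. (\<And>i. i \<in> I \<Longrightarrow> w i \<in> forms n \<and> norm (w i - v i) < \<delta>) \<Longrightarrow> indep_family I w"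
proof -
  obtain l where l: "\<And>i. i \<in> I \<Longrightarrow> linear (l i)" "\<And>i j. i \<in> I \<Longrightarrow> j \<in> I \<Longrightarrow> l i (v j) = (of_bool (i = j) :: real)"
    using indep_family_dual[OF I v(1)] by metis
  have "\<exists>C. i \<in> I \<longrightarrow> C > 0 \<and> (\<forall>y\<in>forms n. norm (l i y) \<le> C * norm y)" for i
  proof (cases "i \<in> I")
    case True
    then obtain C where "C > 0" "\<And>y. y \<in> forms n \<Longrightarrow> norm (l i y) \<le> C * norm y"
      using linear_bounded_on_forms[OF l(1)] by blast
    then show ?thesis
      by blast
  qed simp
  then obtain C where C: "\<And>i. i \<in> I \<Longrightarrow> C i > 0" "\<And>i y. i \<in> I \<Longrightarrow> y \<in> forms n \<Longrightarrow> norm (l i y) \<le> C i * norm y"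
    by metis
  define \<delta> where "\<delta> = 1 / (1 + sum C I)"
  have sumC: "sum C I \<ge> 0"
    by (intro sum_nonneg) (use C(1) in force)
  then have \<delta>: "\<delta> > 0" "sum C I * \<delta> < 1"
    by (simp_all add: \<delta>_def)
  show thesis
  proof (rule that[OF \<delta>(1)])
    fix w assume w: "\<And>i. i \<in> I \<Longrightarrow> w i \<in> forms n \<and> norm (w i - v i) < \<delta>"
    show "indep_family I w"
      unfolding indep_family_def
    proof (intro allI impI)
      fix c assume c: "(\<Sum>i\<in>I. c i *\<^sub>R w i) = 0"
      let ?y = "\<Sum>i\<in>I. c i *\<^sub>R (v i - w i)"
      have y: "?y = (\<Sum>i\<in>I. c i *\<^sub>R v i)"
        using c by (simp add: scaleR_diff_right sum_subtractf)
      have y_forms: "?y \<in> forms n"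
        using v(2) w by (intro subspace_sum[OF subspace_forms] subspace_scale[OF subspace_forms] subspace_diff[OF subspace_forms]) auto
      have "norm ?y \<le> (\<Sum>i\<in>I. \<bar>c i\<bar> * norm (v i - w i))"
        by (rule order_trans[OF norm_sum]) simp
      also have "\<dots> \<le> (\<Sum>i\<in>I. \<bar>c i\<bar> * \<delta>)"
        using w by (intro sum_mono mult_left_mono) (auto simp: norm_minus_commute less_imp_le)
      finally have norm_y: "norm ?y \<le> \<delta> * (\<Sum>i\<in>I. \<bar>c i\<bar>)"
        by (simp add: sum_distrib_left mult.commute)
      have "\<bar>c j\<bar> \<le> C j * (\<delta> * (\<Sum>i\<in>I. \<bar>c i\<bar>))" if j: "j \<in> I" for j
      proof -
        have "l j ?y = (\<Sum>i\<in>I. c i * of_bool (j = i))"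
          unfolding y using j by (simp add: linear_sum[OF l(1)] linear_cmul[OF l(1)] l(2) cong: sum.cong)
        also have "\<dots> = c j"
          using j I by (simp add: of_bool_def if_distrib[of "(*) _"] cong: if_cong)
        finally have "\<bar>c j\<bar> \<le> C j * norm ?y"
          using C(2)[OF j y_forms] by simp
        also have "\<dots> \<le> C j * (\<delta> * (\<Sum>i\<in>I. \<bar>c i\<bar>))"
          using norm_y C(1)[OF j] by (intro mult_left_mono) auto
        finally show ?thesis .
      qed
      then have "(\<Sum>j\<in>I. \<bar>c j\<bar>) \<le> (\<Sum>j\<in>I. C j * (\<delta> * (\<Sum>i\<in>I. \<bar>c i\<bar>)))"
        by (rule sum_mono)
      also have "\<dots> = (sum C I * \<delta>) * (\<Sum>i\<in>I. \<bar>c i\<bar>)"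
        by (simp add: sum_distrib_right mult.assoc)
      finally have "(1 - sum C I * \<delta>) * (\<Sum>i\<in>I. \<bar>c i\<bar>) \<le> 0"
        by (simp add: algebra_simps)
      then have "(\<Sum>i\<in>I. \<bar>c i\<bar>) \<le> 0"
        using \<delta>(2) by (simp add: mult_le_0_iff)
      then have "(\<Sum>i\<in>I. \<bar>c i\<bar>) = 0"
        by (simp add: sum_nonneg order_antisym)
      then show "\<forall>i\<in>I. c i = 0"
        using I by (simp add: sum_nonneg_eq_0_iff)
    qed
  qed
qed

section \<open>Density and the main theorem\<close>

text \<open>
  Baire's argument for finitely many sets: move into one set after the other, each time so little that
  the sets already reached are not left.
\<close>
lemma open_dense_Inter:
  fixes S :: "'a::metric_space set"
  assumes "finite R" "\<And>r. r \<in> R \<Longrightarrow> openin (top_of_set S) (W r)" "\<And>r. r \<in> R \<Longrightarrow> S \<subseteq> closure (W r)"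
  shows "openin (top_of_set S) (S \<inter> (\<Inter>r\<in>R. W r)) \<and> S \<subseteq> closure (S \<inter> (\<Inter>r\<in>R. W r))"
  using assms
proof (induction R rule: finite_induct)
  case empty
  then show ?case
    using closure_subset[of S] by simp
next
  case (insert r R)
  let ?A = "S \<inter> (\<Inter>r\<in>R. W r)"
  have A: "openin (top_of_set S) ?A" "S \<subseteq> closure ?A"
    using insert by auto
  have eq: "S \<inter> (\<Inter>r\<in>insert r R. W r) = ?A \<inter> W r"
    by auto
  have "S \<subseteq> closure (?A \<inter> W r)"
  proof
    fix f assume f: "f \<in> S"
    show "f \<in> closure (?A \<inter> W r)"
      unfolding closure_approachable
    proof (intro allI impI)
      fix \<epsilon> :: real assume \<epsilon>: "\<epsilon> > 0"
      then obtain g where g: "g \<in> ?A" "dist g f < \<epsilon> / 2"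
        using A(2) f closure_approachable[of f ?A] by (meson half_gt_zero subsetD)
      then obtain e where e: "e > 0" "ball g e \<inter> S \<subseteq> ?A"
        using A(1) unfolding openin_contains_ball by blast
      have "g \<in> closure (W r)"
        using insert.prems(2)[of r] g(1) by auto
      then obtain h where h: "h \<in> W r" "dist h g < min e (\<epsilon> / 2)"
        using closure_approachable[of g "W r"] e(1) \<epsilon> by (metis half_gt_zero min_less_iff_conj)
      have "h \<in> S"
        using insert.prems(1)[of r] h(1) openin_imp_subset by blast
      then have "h \<in> ?A"
        using e(2) h(2) by (auto simp: dist_commute)
      moreover have "dist h f < \<epsilon>"
        using g(2) h(2) dist_triangle[of h f g] by simp
      ultimately show "\<exists>y\<in>?A \<inter> W r. dist y f < \<epsilon>"
        using h(1) by blast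
    qed
  qed
  moreover have "openin (top_of_set S) (?A \<inter> W r)"
    by (intro openin_Int A(1) insert.prems(1)) simp
  ultimately show ?case
    unfolding eq by blast
qed

lemma avoid_finite_near_zero:
  fixes \<phi> :: "real \<Rightarrow> 'a::metric_space"
  assumes "finite B" "isCont \<phi> 0" "\<epsilon> > 0"
  shows "\<exists>t. t \<notin> B \<and> dist (\<phi> t) (\<phi> 0) < \<epsilon>"
proof -
  obtain \<delta> where \<delta>: "\<delta> > 0" "\<And>t. dist t 0 < \<delta> \<Longrightarrow> dist (\<phi> t) (\<phi> 0) < \<epsilon>"
    using assms(2,3) unfolding continuous_at_eps_delta by metis
  have "infinite {0<..<\<delta>}"
    using \<delta>(1) by (rule infinite_Ioo)
  then obtain t where "t \<in> {0<..<\<delta>}" "t \<notin> B"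
    using assms(1) by (meson finite_subset subsetI)
  then show ?thesis
    using \<delta>(2)[of t] by auto
qed

definition segment :: "(nat \<Rightarrow> bipoly) \<Rightarrow> (nat \<Rightarrow> bipoly) \<Rightarrow> real \<Rightarrow> nat \<Rightarrow> bipoly" where
  "segment p q t i = p i + t *\<^sub>R (q i - p i)"

lemma segment_ends: "segment p q 0 = p" "segment p q 1 = q"
  by (simp_all add: segment_def fun_eq_iff)

lemma segment_in_forms: "p i \<in> forms d \<Longrightarrow> q i \<in> forms d \<Longrightarrow> segment p q t i \<in> forms d"
  unfolding segment_def by (intro forms_closed)

lemma poly_curve_mult_affine: 
  fixes a b c e :: bipoly
  shows "poly_curve (\<lambda>t. (a + t *\<^sub>R b) * (c + t *\<^sub>R e))"
proof -
  have "(a + t *\<^sub>R b) * (c + t *\<^sub>R e) = a * c + (t ^ 1 *\<^sub>R (a * e + b * c) + t ^ 2 *\<^sub>R (b * e))" for t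
    by (simp add: distrib_left distrib_right scaleR_bipoly_mult scaleR_add_right power2_eq_square)
  then show ?thesis
    by (simp only:) (intro poly_curve_add poly_curve_const poly_curve_power)
qed

lemma finite_not_qindep_segment:
  assumes "qindep r (segment p q c)"
  shows "finite {t. \<not> qindep r (segment p q t)}"
  using assms unfolding qindep_iff
proof (rule finite_dependent_poly_curve[rotated 2])
  show "poly_curve (\<lambda>t. case k of (i, j) \<Rightarrow> segment p q t i * segment p q t j)" for k
    unfolding segment_def case_prod_beta' by (rule poly_curve_mult_affine)
qed (rule finite_upper)

lemma finite_not_sylvester_segment:
  assumes "indep_family {..2 * d} (sylvester d (segment p q c 0) (segment p q c 1))"
  shows "finite {t. \<not> indep_family {..2 * d} (sylvester d (segment p q t 0) (segment p q t 1))}"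
  using assms
proof (rule finite_dependent_poly_curve[rotated 2])
  show "poly_curve (\<lambda>t. sylvester d (segment p q t 0) (segment p q t 1) k)" for k
    using poly_curve_mult_affine[of "p 0" "q 0 - p 0" "mon d k" 0]
      poly_curve_mult_affine[of "p 1" "q 1 - p 1" "mon d (k - d)" 0]
    by (cases "k \<le> d") (simp_all add: sylvester_def segment_def)
qed simp

lemma isCont_sum_squares_segment: "isCont (\<lambda>t. \<Sum>i<r. (segment p q t i)\<^sup>2) 0"
proof -
  have square: "(a + t *\<^sub>R b)\<^sup>2 = a\<^sup>2 + (t *\<^sub>R (a * b + b * a) + t\<^sup>2 *\<^sub>R b\<^sup>2)" for a b :: bipoly and t
    by (simp only: power2_eq_square distrib_left distrib_right scaleR_bipoly_mult scaleR_add_right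
        scaleR_scaleR add_ac)
  show ?thesis
    unfolding segment_def square
    by (intro continuous_sum continuous_add continuous_scaleR continuous_power continuous_ident continuous_const)
qed

lemma sylvester_monomials: "k \<le> 2 * d \<Longrightarrow> sylvester d (mon d 0) (mon d d) k = mon (2 * d) k"
  by (auto simp: sylvester_def mon_mult mult_2)

text \<open>
  Start from a representation by two squares and zeros. A small step towards a quadratically independent
  tuple makes the tuple quadratically independent; a second small step towards \<open>(y\<^sup>d, x\<^sup>d, 0, \<dots>)\<close> preserves this and
  makes the first two forms generate.
\<close>
lemma exists_near_good_squares:
  assumes r: "r \<ge> 2" "(r + 1) choose 2 \<le> 2 * d + 1" and f: "f \<in> sos_cone d" and "\<epsilon> > 0"
  shows "\<exists>p. (\<forall>i<r. p i \<in> forms d) \<and> qindep r p \<and> generates d (p 0) (p 1) \<and> dist (\<Sum>i<r. (p i)\<^sup>2) f < \<epsilon>"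
proof -
  obtain a b where ab: "a \<in> forms d" "b \<in> forms d" "f = a\<^sup>2 + b\<^sup>2"
    using f by (rule sos_cone_two_squares)
  obtain s where s: "r = Suc (Suc s)"
    using r(1) by (metis add_2_eq_Suc le_Suc_ex)
  define p0 where "p0 = (\<lambda>i::nat. if i = 0 then a else if i = 1 then b else 0)"
  have p0: "p0 i \<in> forms d" for i
    using ab subspace_0[OF subspace_forms] by (simp add: p0_def)
  have f0: "(\<Sum>i<r. (p0 i)\<^sup>2) = f"
    unfolding s sum.lessThan_Suc_shift by (simp add: p0_def ab)
  obtain q where q: "\<And>i. q i \<in> forms d" "qindep r q"
    using exists_qindep[OF r] by blast
  have "finite {t. \<not> qindep r (segment p0 q t)}"
    by (rule finite_not_qindep_segment[where c = 1]) (simp add: segment_ends q)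
  then obtain t1 where t1: "qindep r (segment p0 q t1)"
    "dist (\<Sum>i<r. (segment p0 q t1 i)\<^sup>2) (\<Sum>i<r. (segment p0 q 0 i)\<^sup>2) < \<epsilon> / 2"
    using avoid_finite_near_zero[OF _ isCont_sum_squares_segment[where p = p0 and q = q and r = r], where \<epsilon> = "\<epsilon> / 2"] \<open>\<epsilon> > 0\<close> by auto
  define p1 where "p1 = segment p0 q t1"
  have p1: "p1 i \<in> forms d" for i
    unfolding p1_def by (intro segment_in_forms p0 q)
  define e where "e = (\<lambda>i::nat. if i = 0 then mon d 0 else if i = 1 then mon d d else 0)"
  have e: "e i \<in> forms d" for i
    using subspace_0[OF subspace_forms] by (simp add: e_def mon_in_forms)
  have "finite {t. \<not> qindep r (segment p1 e t)}"
    by (rule finite_not_qindep_segment[where c = 0]) (simp add: segment_ends p1_def t1)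
  moreover have "finite {t. \<not> indep_family {..2 * d} (sylvester d (segment p1 e t 0) (segment p1 e t 1))}"
  proof (rule finite_not_sylvester_segment[where c = 1])
    have "indep_family {..2 * d} (sylvester d (mon d 0) (mon d d)) \<longleftrightarrow> indep_family {..2 * d} (mon (2 * d))"
      by (rule indep_family_cong) (simp add: sylvester_monomials)
    then show "indep_family {..2 * d} (sylvester d (segment p1 e 1 0) (segment p1 e 1 1))"
      by (simp add: segment_ends e_def indep_family_mon)
  qed
  ultimately have fin: "finite ({t. \<not> qindep r (segment p1 e t)}
      \<union> {t. \<not> indep_family {..2 * d} (sylvester d (segment p1 e t 0) (segment p1 e t 1))})"
    by simp
  obtain t2 where t2: "qindep r (segment p1 e t2)"
    "indep_family {..2 * d} (sylvester d (segment p1 e t2 0) (segment p1 e t2 1))"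
    "dist (\<Sum>i<r. (segment p1 e t2 i)\<^sup>2) (\<Sum>i<r. (segment p1 e 0 i)\<^sup>2) < \<epsilon> / 2"
    using avoid_finite_near_zero[OF fin isCont_sum_squares_segment[where p = p1 and q = e and r = r]
        half_gt_zero[OF \<open>\<epsilon> > 0\<close>]] by blast
  define p2 where "p2 = segment p1 e t2"
  have p2: "p2 i \<in> forms d" for i
    unfolding p2_def by (intro segment_in_forms p1 e)
  have "dist (\<Sum>i<r. (p2 i)\<^sup>2) (\<Sum>i<r. (p1 i)\<^sup>2) < \<epsilon> / 2" "dist (\<Sum>i<r. (p1 i)\<^sup>2) f < \<epsilon> / 2"
    using t1(2) t2(3) by (simp_all add: segment_ends p2_def p1_def f0)
  then have "dist (\<Sum>i<r. (p2 i)\<^sup>2) f < \<epsilon>"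
    using dist_triangle[of "\<Sum>i<r. (p2 i)\<^sup>2" f "\<Sum>i<r. (p1 i)\<^sup>2"] by simp
  moreover have "generates d (p2 0) (p2 1)"
    using generates_if_sylvester_indep[OF p2 p2] t2(2) by (simp add: p2_def)
  ultimately show ?thesis
    using p2 t2(1) p2_def by blast
qed

definition qindep_squares :: "nat \<Rightarrow> nat \<Rightarrow> bipoly set" where
  "qindep_squares d r = {\<Sum>i<r. (p i)\<^sup>2 |p. (\<forall>i<r. p i \<in> forms d) \<and> qindep r p}"

lemma sos_cone_subset_forms: "sos_cone d \<subseteq> forms (2 * d)"
  unfolding sos_cone_def by (auto intro!: subspace_sum[OF subspace_forms] forms_square)

text \<open>
  Nearby forms are reached by changing \<open>p 0\<close> and \<open>p 1\<close> a little, and quadratic independence survives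
  small changes.
\<close>
lemma good_squares_interior:
  assumes r: "r \<ge> 2" and p: "\<And>i. i < r \<Longrightarrow> p i \<in> forms d" and q: "qindep r p" and gen: "generates d (p 0) (p 1)"
  shows "\<exists>e>0. ball (\<Sum>i<r. (p i)\<^sup>2) e \<inter> sos_cone d \<subseteq> qindep_squares d r"
proof -
  obtain s where s: "r = Suc (Suc s)"
    using r by (metis add_2_eq_Suc le_Suc_ex)
  obtain \<delta> where \<delta>: "\<delta> > 0" "\<And>w. (\<And>k. k \<in> upper r \<Longrightarrow> w k \<in> forms (2 * d) \<and> norm (w k - (\<lambda>(i, j). p i * p j) k) < \<delta>)
      \<Longrightarrow> indep_family (upper r) w"
  proof (rule indep_family_stable[OF finite_upper q[unfolded qindep_iff]])
    show "(case k of (i, j) \<Rightarrow> p i * p j) \<in> forms (2 * d)" if "k \<in> upper r" for k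
      using that p unfolding mult_2 by (auto simp: upper_def intro!: forms_mult)
  qed blast
  define K where "K = (\<Sum>i<r. norm (p i))"
  have K: "norm (p i) \<le> K" if "i < r" for i
    unfolding K_def using that by (intro member_le_sum) auto
  have K0: "K \<ge> 0"
    unfolding K_def by (intro sum_nonneg) simp
  \<comment> \<open>with \<open>\<eta> \<le> 1\<close> the products move by at most \<open>\<eta> (2 K + 1)\<close>\<close>
  define \<eta> where "\<eta> = min 1 (\<delta> / (2 * K + 2))"
  have \<eta>: "\<eta> > 0" "\<eta> \<le> 1" "\<eta> * (2 * K + 1) < \<delta>"
  proof -
    show "\<eta> > 0" "\<eta> \<le> 1"
      using \<delta>(1) K0 by (simp_all add: \<eta>_def)
    have "\<eta> * (2 * K + 1) < \<eta> * (2 * K + 2)"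
      using \<open>\<eta> > 0\<close> by simp
    also have "\<dots> \<le> \<delta> / (2 * K + 2) * (2 * K + 2)"
      using K0 by (intro mult_right_mono) (auto simp: \<eta>_def)
    also have "\<dots> = \<delta>"
      using K0 by simp
    finally show "\<eta> * (2 * K + 1) < \<delta>" .
  qed
  have close: "qindep r p'" if p': "\<And>i. i < r \<Longrightarrow> p' i \<in> forms d" "\<And>i. i < r \<Longrightarrow> norm (p' i - p i) < \<eta>" for p'
    unfolding qindep_iff
  proof (rule \<delta>(2))
    fix k assume "k \<in> upper r"
    then obtain i j where k: "k = (i, j)" "i < r" "j < r"
      by (auto simp: upper_def)
    have "p' i * p' j - p i * p j = (p' i - p i) * p' j + p i * (p' j - p j)"
      by (simp add: algebra_simps)
    then have "norm (p' i * p' j - p i * p j) \<le> norm (p' i - p i) * norm (p' j) + norm (p i) * norm (p' j - p j)"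
      using norm_triangle_ineq[of "(p' i - p i) * p' j" "p i * (p' j - p j)"]
        norm_bipoly_mult[of "p' i - p i" "p' j"] norm_bipoly_mult[of "p i" "p' j - p j"] by simp
    also have "\<dots> \<le> \<eta> * (K + 1) + K * \<eta>"
    proof (intro add_mono mult_mono)
      show "norm (p' j) \<le> K + 1"
        using norm_triangle_ineq[of "p' j - p j" "p j"] p'(2)[OF k(3)] K[OF k(3)] \<eta>(2) by simp
    qed (use p'(2)[OF k(2)] p'(2)[OF k(3)] K[OF k(2)] K0 \<eta>(1) in auto)
    also have "\<dots> = \<eta> * (2 * K + 1)"
      by (simp add: algebra_simps)
    finally have "norm (p' i * p' j - p i * p j) < \<delta>"
      using \<eta>(3) by simp
    moreover have "p' i * p' j \<in> forms (2 * d)"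
      unfolding mult_2 using p'(1) k by (intro forms_mult) auto
    ultimately show "(case k of (i, j) \<Rightarrow> p' i * p' j) \<in> forms (2 * d) \<and>
        norm ((case k of (i, j) \<Rightarrow> p' i * p' j) - (\<lambda>(i, j). p i * p j) k) < \<delta>"
      by (simp add: k(1))
  qed
  have p01: "p 0 \<in> forms d" "p 1 \<in> forms d"
    using p s by auto
  obtain e where e: "e > 0" "\<And>h. h \<in> forms (2 * d) \<Longrightarrow> norm h < e \<Longrightarrow>
    \<exists>a\<in>forms d. \<exists>b\<in>forms d. norm a < \<eta> \<and> norm b < \<eta> \<and> (p 0 + a)\<^sup>2 + (p 1 + b)\<^sup>2 = (p 0)\<^sup>2 + (p 1)\<^sup>2 + h"
    using sum_two_squares_locally_surjective[OF p01 gen \<eta>(1)] by blast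
  let ?f = "\<Sum>i<r. (p i)\<^sup>2"
  have "g \<in> qindep_squares d r" if g: "g \<in> ball ?f e" "g \<in> sos_cone d" for g
  proof -
    have "?f \<in> forms (2 * d)"
      using p by (intro subspace_sum[OF subspace_forms] forms_square) auto
    then have "g - ?f \<in> forms (2 * d)"
      using sos_cone_subset_forms g(2) by (intro subspace_diff[OF subspace_forms]) auto
    moreover have "norm (g - ?f) < e"
      using g(1) by (simp add: dist_norm norm_minus_commute)
    ultimately obtain a b where ab: "a \<in> forms d" "b \<in> forms d" "norm a < \<eta>" "norm b < \<eta>"
      "(p 0 + a)\<^sup>2 + (p 1 + b)\<^sup>2 = (p 0)\<^sup>2 + (p 1)\<^sup>2 + (g - ?f)"
      using e(2) by blast
    define p' where "p' = (\<lambda>i. if i = 0 then p 0 + a else if i = 1 then p 1 + b else p i)"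
    have p': "p' i \<in> forms d" if "i < r" for i
      using ab p01 p[OF that] by (auto simp: p'_def intro!: subspace_add[OF subspace_forms])
    have "qindep r p'"
      by (rule close[OF p']) (use ab \<eta>(1) in \<open>auto simp: p'_def\<close>)
    moreover have "(\<Sum>i<r. (p' i)\<^sup>2) = g"
    proof -
      have split: "(\<Sum>i<r. (h i)\<^sup>2) = (h 0)\<^sup>2 + (h 1)\<^sup>2 + (\<Sum>i<s. (h (Suc (Suc i)))\<^sup>2)" for h :: "nat \<Rightarrow> bipoly"
        unfolding s sum.lessThan_Suc_shift by (simp add: add.assoc)
      have "(\<Sum>i<r. (p' i)\<^sup>2) = (p 0 + a)\<^sup>2 + (p 1 + b)\<^sup>2 + (\<Sum>i<s. (p (Suc (Suc i)))\<^sup>2)"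
        unfolding split by (simp add: p'_def)
      also have "\<dots> = ((p 0)\<^sup>2 + (p 1)\<^sup>2 + (\<Sum>i<s. (p (Suc (Suc i)))\<^sup>2)) + (g - ?f)"
        unfolding ab(5) by (simp only: add_ac)
      also have "\<dots> = g"
        by (simp only: split[of p, symmetric]) simp
      finally show ?thesis .
    qed
    ultimately show ?thesis
      using p' unfolding qindep_squares_def by blast
  qed
  then show ?thesis
    using e(1) by blast
qed

theorem theorem5p3:
  fixes d :: nat
  assumes "d \<ge> 1"
  shows "\<exists>U. openin (top_of_set (sos_cone d)) U \<and> sos_cone d \<subseteq> closure U \<and>
    (\<forall>f\<in>U. \<forall>r::nat. r \<ge> 2 \<and> (r + 1) choose 2 \<le> 2 * d + 1 \<longrightarrow>
      (\<exists>\<theta>. \<theta> extreme_point_of Gram d f \<and> tensor_rank \<theta> = r))"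
proof -
  define R where "R = {r. r \<ge> 2 \<and> (r + 1) choose 2 \<le> 2 * d + 1}"
  define W where "W r = {f \<in> sos_cone d. \<exists>e>0. ball f e \<inter> sos_cone d \<subseteq> qindep_squares d r}" for r
  have "r \<le> (r + 1) choose 2" for r :: nat
    by (simp add: numeral_2_eq_2)
  then have "R \<subseteq> {..2 * d + 1}"
    unfolding R_def using le_trans by blast
  then have "finite R"
    using finite_subset by blast
  moreover have "openin (top_of_set (sos_cone d)) (W r)" for r
    unfolding openin_contains_ball
  proof (intro conjI ballI)
    fix f assume "f \<in> W r"
    then obtain e where e: "e > 0" "ball f e \<inter> sos_cone d \<subseteq> qindep_squares d r"
      by (auto simp: W_def)
    have "g \<in> W r" if g: "g \<in> ball f (e / 2) \<inter> sos_cone d" for g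
    proof -
      have "ball g (e / 2) \<subseteq> ball f e"
      proof
        fix h assume "h \<in> ball g (e / 2)"
        then show "h \<in> ball f e"
          using g dist_triangle[of f h g] by auto
      qed
      then show ?thesis
        using e g unfolding W_def by (auto intro!: exI[of _ "e / 2"])
    qed
    then show "\<exists>e>0. ball f e \<inter> sos_cone d \<subseteq> W r"
      using e(1) by (intro exI[of _ "e / 2"]) auto
  qed (auto simp: W_def)
  moreover have "sos_cone d \<subseteq> closure (W r)" if r: "r \<in> R" for r
  proof
    fix f assume f: "f \<in> sos_cone d"
    show "f \<in> closure (W r)"
      unfolding closure_approachable
    proof (intro allI impI)
      fix \<epsilon> :: real assume "\<epsilon> > 0"
      then obtain p where p: "\<forall>i<r. p i \<in> forms d" "qindep r p" "generates d (p 0) (p 1)"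
        "dist (\<Sum>i<r. (p i)\<^sup>2) f < \<epsilon>"
        using exists_near_good_squares[of r d f \<epsilon>] r f unfolding R_def by blast
      have "(\<Sum>i<r. (p i)\<^sup>2) \<in> W r"
        using good_squares_interior[of r p d] p r unfolding W_def R_def sos_cone_def by blast
      then show "\<exists>y\<in>W r. dist y f < \<epsilon>"
        using p(4) by blast
    qed
  qed
  ultimately have U: "openin (top_of_set (sos_cone d)) (sos_cone d \<inter> (\<Inter>r\<in>R. W r))"
    "sos_cone d \<subseteq> closure (sos_cone d \<inter> (\<Inter>r\<in>R. W r))"
    using open_dense_Inter[of R "sos_cone d" W] by blast+
  have "\<exists>\<theta>. \<theta> extreme_point_of Gram d f \<and> tensor_rank \<theta> = r" if "f \<in> W r" for f r
  proof -
    have "f \<in> qindep_squares d r"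
      using that by (auto simp: W_def)
    then obtain p where "f = (\<Sum>i<r. (p i)\<^sup>2)" "\<And>i. i < r \<Longrightarrow> p i \<in> forms d" "qindep r p"
      by (auto simp: qindep_squares_def)
    then show ?thesis
      using qindep_extreme_point[of r p d] by blast
  qed
  then have "\<forall>f\<in>sos_cone d \<inter> (\<Inter>r\<in>R. W r). \<forall>r::nat. r \<ge> 2 \<and> (r + 1) choose 2 \<le> 2 * d + 1 \<longrightarrow>
      (\<exists>\<theta>. \<theta> extreme_point_of Gram d f \<and> tensor_rank \<theta> = r)"
    unfolding R_def by blast
  then show ?thesis
    using U by blast
qed

end
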